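(* Let $X$ and $Y$ be the subproduct systems associated with homogeneous ideals $\mathcal I$ of $\mathbb C\langle x_1,\dots,x_d\rangle$ and $\mathcal J$ of $\mathbb C\langle y_1,\dots,y_{d'}\rangle$. If $\phi:\mathcal A_X\to\mathcal A_Y$ is an algebraic (resp. bounded, isometric) isomorphism, then there exists a vacuum preserving algebraic (resp. bounded, isometric) isomorphism $\phi':\mathcal A_X\to\mathcal A_Y$.
   Context: $\mathbb C\langle x_1,\dots,x_d\rangle$ is the ring of polynomials in $d$ noncommuting variables; a homogeneous ideal is a two-sided ideal generated by homogeneous polynomials, here assumed proper. Let $\{e_1,\dots,e_d\}$ be the standard orthonormal basis of $\mathbb C^d$, and for $f=\sum_w\lambda_wx^w$ (sum over words $w=w_1\cdots w_n$) put $f(\underline e)=\sum_w\lambda_we_{w_1}\otimes\cdots\otimes e_{w_n}$. The subproduct system associated with $\mathcal I$ is $X=(X(n),p_n)_{n\ge0}$, where $X(n)=(\mathbb C^d)^{\otimes n}\ominus\{f(\underline e): f\in\mathcal I\text{ homogeneous of degree }n\}$ and $p_n$ is the orthogonal projection of $(\mathbb C^d)^{\otimes n}$ onto $X(n)$. Let $\mathcal F_X=\bigoplus_{n\ge0}X(n)$ and $T_i\xi=p_{n+1}(e_i\otimes\xi)$ for $\xi\in X(n)$. The tensor algebra $\mathcal A_X$ is the norm-closed unital algebra generated by $T_1,\dots,T_d$. A character of $\mathcal A_X$ is a nonzero homomorphism into $\mathbb C$; $\rho_0$ denotes the (vacuum) character of $\mathcal A_X$ with $\rho_0(T_i)=0$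 for all $i$, and likewise for $\mathcal A_Y$. An isomorphism $\phi:\mathcal A_X\to\mathcal A_Y$ is vacuum preserving if $\rho_0\circ\phi=\rho_0$. *)

theory Defs
  imports "HOL-Analysis.Analysis" "HOL-Library.Poly_Mapping"
begin

section \<open>Noncommutative polynomials and homogeneous ideals\<close>

text \<open>Words over \<open>'d\<close> form the free monoid, so \<open>'d list \<Rightarrow>\<^sub>0 complex\<close>, with the convolution product
  of \<^theory>\<open>HOL-Library.Poly_Mapping\<close>, is the ring of polynomials in noncommuting variables indexed
  by \<open>'d\<close>. Here \<open>Poly_Mapping.lookup f w\<close> is the coefficient of \<open>x\<^sup>w\<close>.\<close>

instantiation list :: (type) monoid_add
begin

definition zero_list :: "'a list" where "zero_list = []"

definition plus_list :: "'a list \<Rightarrow> 'a list \<Rightarrow> 'a list" where "plus_list u v = u @ v"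

instance by standard (simp_all add: zero_list_def plus_list_def)

end

type_synonym 'd ncpoly = "'d list \<Rightarrow>\<^sub>0 complex"

definition homogeneous_poly :: "nat \<Rightarrow> 'd ncpoly \<Rightarrow> bool" where
  "homogeneous_poly n f \<longleftrightarrow> (\<forall>w\<in>Poly_Mapping.keys f. length w = n)"

definition two_sided_ideal :: "'r::ring_1 set \<Rightarrow> bool" where
  "two_sided_ideal I \<longleftrightarrow>
     0 \<in> I \<and> (\<forall>f\<in>I. \<forall>g\<in>I. f + g \<in> I) \<and> (\<forall>f\<in>I. \<forall>r. r * f \<in> I \<and> f * r \<in> I)"

definition homogeneous_ideal :: "'d ncpoly set \<Rightarrow> bool" where
  "homogeneous_ideal I \<longleftrightarrow>
     (\<exists>S. (\<forall>f\<in>S. \<exists>n. homogeneous_poly n f) \<and> I = two_sided_ideal hull S) \<and> I \<noteq> UNIV"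


section \<open>The Hilbert space of square-summable families\<close>

typedef 'a ell2 = "{f :: 'a \<Rightarrow> complex. (\<lambda>x. (cmod (f x))\<^sup>2) summable_on UNIV}"
  morphisms coord Abs_ell2
  by (rule exI[of _ "\<lambda>_. 0"]) simp

setup_lifting type_definition_ell2

lemma sq_summable_add:
  fixes f g :: "'a \<Rightarrow> complex"
  assumes "(\<lambda>x. (cmod (f x))\<^sup>2) summable_on UNIV" "(\<lambda>x. (cmod (g x))\<^sup>2) summable_on UNIV"
  shows "(\<lambda>x. (cmod (f x + g x))\<^sup>2) summable_on UNIV"
proof (rule summable_on_comparison_test)
  show "(\<lambda>x. 2 * (cmod (f x))\<^sup>2 + 2 * (cmod (g x))\<^sup>2) summable_on UNIV"
    by (intro summable_on_add summable_on_cmult_right assms)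
  fix x
  have "(cmod (f x + g x))\<^sup>2 \<le> (cmod (f x) + cmod (g x))\<^sup>2"
    by (intro power_mono norm_triangle_ineq) auto
  also have "\<dots> \<le> 2 * (cmod (f x))\<^sup>2 + 2 * (cmod (g x))\<^sup>2"
    using zero_le_power2[of "cmod (f x) - cmod (g x)"]
    by (simp add: power2_eq_square algebra_simps)
  finally show "(cmod (f x + g x))\<^sup>2 \<le> 2 * (cmod (f x))\<^sup>2 + 2 * (cmod (g x))\<^sup>2" .
qed auto

lemma sq_summable_cmult:
  fixes f :: "'a \<Rightarrow> complex"
  assumes "(\<lambda>x. (cmod (f x))\<^sup>2) summable_on UNIV"
  shows "(\<lambda>x. (cmod (c * f x))\<^sup>2) summable_on UNIV"
  using summable_on_cmult_right[OF assms, of "(cmod c)\<^sup>2"]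
  by (simp add: norm_mult power_mult_distrib)

lift_definition cscale :: "complex \<Rightarrow> 'a ell2 \<Rightarrow> 'a ell2" is "\<lambda>c f x. c * f x"
  by (rule sq_summable_cmult)

lift_definition cinner :: "'a ell2 \<Rightarrow> 'a ell2 \<Rightarrow> complex" is
  "\<lambda>f g. \<Sum>\<^sub>\<infinity>x. f x * cnj (g x)" .

lemma sq_summable_prod_abs:
  fixes f g :: "'a \<Rightarrow> complex"
  assumes "(\<lambda>x. (cmod (f x))\<^sup>2) summable_on UNIV" "(\<lambda>x. (cmod (g x))\<^sup>2) summable_on UNIV"
  shows "(\<lambda>x. norm (f x * cnj (g x))) summable_on UNIV"
proof (rule summable_on_comparison_test)
  show "(\<lambda>x. (cmod (f x))\<^sup>2 + (cmod (g x))\<^sup>2) summable_on UNIV"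
    by (intro summable_on_add assms)
  fix x
  have "2 * (cmod (f x) * cmod (g x)) \<le> (cmod (f x))\<^sup>2 + (cmod (g x))\<^sup>2"
    using zero_le_power2[of "cmod (f x) - cmod (g x)"]
    by (simp add: power2_eq_square algebra_simps)
  moreover have "0 \<le> cmod (f x) * cmod (g x)" by simp
  ultimately have "cmod (f x) * cmod (g x) \<le> (cmod (f x))\<^sup>2 + (cmod (g x))\<^sup>2" by linarith
  then show "norm (f x * cnj (g x)) \<le> (cmod (f x))\<^sup>2 + (cmod (g x))\<^sup>2"
    by (simp add: norm_mult)
qed auto

lemma sq_summable_prod:
  fixes f g :: "'a \<Rightarrow> complex"
  assumes "(\<lambda>x. (cmod (f x))\<^sup>2) summable_on UNIV" "(\<lambda>x. (cmod (g x))\<^sup>2) summable_on UNIV"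
  shows "(\<lambda>x. f x * cnj (g x)) summable_on UNIV"
  by (rule Infinite_Sum.abs_summable_summable[OF sq_summable_prod_abs[OF assms]])

instantiation ell2 :: (type) real_vector
begin

lift_definition zero_ell2 :: "'a ell2" is "\<lambda>_. 0" by simp
lift_definition plus_ell2 :: "'a ell2 \<Rightarrow> 'a ell2 \<Rightarrow> 'a ell2" is "\<lambda>f g x. f x + g x"
  by (rule sq_summable_add)
lift_definition uminus_ell2 :: "'a ell2 \<Rightarrow> 'a ell2" is "\<lambda>f x. - f x" by simp
lift_definition minus_ell2 :: "'a ell2 \<Rightarrow> 'a ell2 \<Rightarrow> 'a ell2" is "\<lambda>f g x. f x - g x"
proof -
  fix f g :: "'a \<Rightarrow> complex"
  assume "(\<lambda>x. (cmod (f x))\<^sup>2) summable_on UNIV" "(\<lambda>x. (cmod (g x))\<^sup>2) summable_on UNIV"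
  then show "(\<lambda>x. (cmod (f x - g x))\<^sup>2) summable_on UNIV"
    using sq_summable_add[of f "\<lambda>x. - g x"] by simp
qed
lift_definition scaleR_ell2 :: "real \<Rightarrow> 'a ell2 \<Rightarrow> 'a ell2" is "\<lambda>r f x. complex_of_real r * f x"
  by (rule sq_summable_cmult)

instance
  by standard (transfer; auto simp: algebra_simps)+

end

instantiation ell2 :: (type) real_inner
begin

definition inner_ell2 :: "'a ell2 \<Rightarrow> 'a ell2 \<Rightarrow> real" where "inner_ell2 u v = Re (cinner u v)"
definition norm_ell2 :: "'a ell2 \<Rightarrow> real" where "norm_ell2 u = sqrt (inner u u)"
definition dist_ell2 :: "'a ell2 \<Rightarrow> 'a ell2 \<Rightarrow> real" where "dist_ell2 u v = norm (u - v)"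
definition sgn_ell2 :: "'a ell2 \<Rightarrow> 'a ell2" where "sgn_ell2 u = u /\<^sub>R norm u"
definition uniformity_ell2 :: "('a ell2 \<times> 'a ell2) filter" where
  "uniformity_ell2 = (INF e\<in>{0<..}. principal {(u, v). dist u v < e})"
definition open_ell2 :: "'a ell2 set \<Rightarrow> bool" where
  "open_ell2 U \<longleftrightarrow> (\<forall>u\<in>U. \<forall>\<^sub>F (u', v) in uniformity. u' = u \<longrightarrow> v \<in> U)"

lemma cinner_commute: "cinner u v = cnj (cinner v (u :: 'a ell2))"
  by transfer (simp flip: infsum_cnj add: mult.commute)

lemma cinner_add_left: "cinner (u + v) w = cinner u w + cinner v (w :: 'a ell2)"
  by transfer (simp add: distrib_right infsum_add sq_summable_prod)

lemma cinner_scale_left: "cinner (cscale c u) v = c * cinner u (v :: 'a ell2)"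
  by transfer (simp add: infsum_cmult_right' mult.assoc)

lemma scaleR_cscale: "r *\<^sub>R u = cscale (complex_of_real r) (u :: 'a ell2)"
  by transfer simp

lemma cinner_self: "cinner u u = complex_of_real (\<Sum>\<^sub>\<infinity>x. (cmod (coord u x))\<^sup>2)"
proof -
  have "(\<lambda>x. (cmod (coord u x))\<^sup>2) summable_on UNIV" using coord[of u] by simp
  then have "((\<lambda>x. complex_of_real ((cmod (coord u x))\<^sup>2)) has_sum
      complex_of_real (\<Sum>\<^sub>\<infinity>x. (cmod (coord u x))\<^sup>2)) UNIV"
    by (intro has_sum_of_real has_sum_infsum)
  then show ?thesis
    by (simp add: cinner.rep_eq infsumI flip: complex_norm_square)
qed

instance
proof
  fix u v w :: "'a ell2" and r :: real
  show "dist u v = norm (u - v)" "sgn u = u /\<^sub>R norm u" "norm u = sqrt (inner u u)"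
    "uniformity = (INF e\<in>{0<..}. principal {(u :: 'a ell2, v). dist u v < e})"
    by (rule dist_ell2_def sgn_ell2_def norm_ell2_def uniformity_ell2_def)+
  show "open U \<longleftrightarrow> (\<forall>u\<in>U. \<forall>\<^sub>F (u', v) in uniformity. u' = u \<longrightarrow> v \<in> U)" for U :: "'a ell2 set"
    by (rule open_ell2_def)
  show "inner u v = inner v u"
    using cinner_commute[of u v] by (simp add: inner_ell2_def)
  show "inner (u + v) w = inner u w + inner v w"
    by (simp add: inner_ell2_def cinner_add_left)
  show "inner (r *\<^sub>R u) v = r * inner u v"
    by (simp add: inner_ell2_def scaleR_cscale cinner_scale_left)
  show "0 \<le> inner u u"
    by (simp add: inner_ell2_def cinner_self infsum_nonneg)
  show "inner u u = 0 \<longleftrightarrow> u = 0"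
  proof
    assume "inner u u = 0"
    then have "(\<Sum>\<^sub>\<infinity>x. (cmod (coord u x))\<^sup>2) = 0" by (simp add: inner_ell2_def cinner_self)
    then have "(cmod (coord u x))\<^sup>2 = 0" for x
      using coord[of u] by (intro nonneg_infsum_le_0D[of "\<lambda>x. (cmod (coord u x))\<^sup>2" UNIV]) auto
    then show "u = 0" by (simp add: coord_inject[symmetric] zero_ell2.rep_eq fun_eq_iff)
  qed (simp add: inner_ell2_def cinner_self zero_ell2.rep_eq)
qed

end

lemma ell2_eqI: "(\<And>x. coord u x = coord v x) \<Longrightarrow> u = v"
  by (simp add: coord_inject[symmetric] fun_eq_iff)

lemma norm_ell2_sq: "(norm u)\<^sup>2 = (\<Sum>\<^sub>\<infinity>x. (cmod (coord u x))\<^sup>2)"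
  by (simp add: norm_ell2_def inner_ell2_def cinner_self infsum_nonneg)

lemma cmod_coord_le: "cmod (coord u x) \<le> norm u"
proof -
  have "(\<Sum>y\<in>{x}. (cmod (coord u y))\<^sup>2) \<le> (\<Sum>\<^sub>\<infinity>x. (cmod (coord u x))\<^sup>2)"
    using coord[of u] by (intro finite_sum_le_infsum) auto
  then have "(cmod (coord u x))\<^sup>2 \<le> (norm u)\<^sup>2" by (simp add: norm_ell2_sq)
  then show ?thesis by (rule power2_le_imp_le) simp
qed

lemma sum_coord_le: "finite F \<Longrightarrow> (\<Sum>x\<in>F. (cmod (coord u x))\<^sup>2) \<le> (norm u)\<^sup>2"
  unfolding norm_ell2_sq using coord[of u] by (intro finite_sum_le_infsum) auto

lemma sum_le_imp_sq_summable:
  assumes "\<And>F. finite F \<Longrightarrow> (\<Sum>x\<in>F. (cmod (f x))\<^sup>2) \<le> C"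
  shows "(\<lambda>x. (cmod (f x))\<^sup>2) summable_on UNIV"
  by (rule nonneg_bdd_above_summable_on) (auto intro!: bdd_aboveI[of _ C] assms)

lemma norm_ell2_leI:
  assumes "\<And>F. finite F \<Longrightarrow> (\<Sum>x\<in>F. (cmod (coord u x))\<^sup>2) \<le> C\<^sup>2" "0 \<le> C"
  shows "norm u \<le> C"
proof -
  have "(norm u)\<^sup>2 \<le> C\<^sup>2"
    unfolding norm_ell2_sq using coord[of u] by (intro infsum_le_finite_sums assms) auto
  then show ?thesis using assms(2) by (rule power2_le_imp_le)
qed

instance ell2 :: (type) banach
proof
  fix X :: "nat \<Rightarrow> 'a ell2"
  assume "Cauchy X"
  have "Cauchy (\<lambda>n. coord (X n) x)" for x
  proof (rule CauchyI)
    fix e :: real assume "e > 0"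
    with \<open>Cauchy X\<close> obtain M where "\<forall>m\<ge>M. \<forall>n\<ge>M. norm (X m - X n) < e"
      by (auto dest: CauchyD)
    then show "\<exists>M. \<forall>m\<ge>M. \<forall>n\<ge>M. norm (coord (X m) x - coord (X n) x) < e"
      by (metis cmod_coord_le le_less_trans minus_ell2.rep_eq)
  qed
  then have "\<forall>x. \<exists>l. (\<lambda>n. coord (X n) x) \<longlonglongrightarrow> l"
    by (simp add: Cauchy_convergent_iff convergent_def)
  then obtain l where l: "\<And>x. (\<lambda>n. coord (X n) x) \<longlonglongrightarrow> l x" by metis
  have tail: "(\<Sum>x\<in>F. (cmod (coord (X m) x - l x))\<^sup>2) \<le> e\<^sup>2"
    if "finite F" "\<And>n. n \<ge> M \<Longrightarrow> norm (X m - X n) \<le> e" "0 \<le> e" for F m M and e :: real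
  proof (rule LIMSEQ_le_const2)
    show "(\<lambda>n. \<Sum>x\<in>F. (cmod (coord (X m) x - coord (X n) x))\<^sup>2)
        \<longlonglongrightarrow> (\<Sum>x\<in>F. (cmod (coord (X m) x - l x))\<^sup>2)"
      by (intro tendsto_intros l)
    show "\<exists>N. \<forall>n\<ge>N. (\<Sum>x\<in>F. (cmod (coord (X m) x - coord (X n) x))\<^sup>2) \<le> e\<^sup>2"
    proof (intro exI allI impI)
      fix n assume "M \<le> n"
      have "(\<Sum>x\<in>F. (cmod (coord (X m - X n) x))\<^sup>2) \<le> (norm (X m - X n))\<^sup>2"
        using that(1) by (rule sum_coord_le)
      also have "\<dots> \<le> e\<^sup>2" using that(2)[OF \<open>M \<le> n\<close>] by (intro power_mono) auto
      finally show "(\<Sum>x\<in>F. (cmod (coord (X m) x - coord (X n) x))\<^sup>2) \<le> e\<^sup>2"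
        by (simp add: minus_ell2.rep_eq)
    qed
  qed
  obtain M1 where M1: "\<forall>m\<ge>M1. \<forall>n\<ge>M1. norm (X m - X n) < 1"
    using CauchyD[OF \<open>Cauchy X\<close>, of 1] by auto
  have "(\<lambda>x. (cmod (coord (X M1) x - l x))\<^sup>2) summable_on UNIV"
    by (rule sum_le_imp_sq_summable[of _ "1\<^sup>2"], rule tail[of _ M1]) (use M1 in \<open>auto intro: less_imp_le\<close>)
  then have "(\<lambda>x. (cmod (l x - coord (X M1) x))\<^sup>2) summable_on UNIV"
    by (simp add: norm_minus_commute)
  then have "(\<lambda>x. (cmod (coord (X M1) x + (l x - coord (X M1) x)))\<^sup>2) summable_on UNIV"
    using coord[of "X M1"] by (intro sq_summable_add) auto
  then have "(\<lambda>x. (cmod (l x))\<^sup>2) summable_on UNIV" by simp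
  then have L: "coord (Abs_ell2 l) = l" by (simp add: Abs_ell2_inverse)
  have "X \<longlonglongrightarrow> Abs_ell2 l"
  proof (rule LIMSEQ_I)
    fix e :: real assume "e > 0"
    then obtain M where M: "\<forall>m\<ge>M. \<forall>n\<ge>M. norm (X m - X n) < e / 2"
      using CauchyD[OF \<open>Cauchy X\<close>, of "e / 2"] by auto
    have "norm (X m - Abs_ell2 l) < e" if "m \<ge> M" for m
    proof -
      have "norm (X m - Abs_ell2 l) \<le> e / 2"
        using M that \<open>e > 0\<close>
        by (intro norm_ell2_leI)
          (auto simp: minus_ell2.rep_eq L intro!: tail[where M = M] intro: less_imp_le)
      then show ?thesis using \<open>e > 0\<close> by simp
    qed
    then show "\<exists>M. \<forall>m\<ge>M. norm (X m - Abs_ell2 l) < e" by blast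
  qed
  then show "convergent X" by (rule convergentI)
qed


subsection \<open>Sesquilinearity, scalars and coordinates\<close>

lemma cinner_cscale_right: "cinner u (cscale c v) = cnj c * cinner u v"
  by (metis cinner_commute cinner_scale_left complex_cnj_mult)

lemma cinner_eq_inner: "cinner u v = Complex (inner u v) (inner u (cscale \<i> v))"
  by (simp add: complex_eq_iff inner_ell2_def cinner_cscale_right)

lemma cinner_diff_left: "cinner (u - v) w = cinner u w - cinner v w"
  by (simp add: cinner_eq_inner inner_diff_left complex_eq_iff)

lemma cinner_zero_left [simp]: "cinner 0 v = 0"
  by (simp add: cinner_eq_inner complex_eq_iff)

lemma tendsto_cinner_left:
  assumes "(f \<longlongrightarrow> u) F" shows "((\<lambda>n. cinner (f n) v) \<longlongrightarrow> cinner u v) F"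
  unfolding cinner_eq_inner by (intro tendsto_intros assms)

lemma norm_cscale [simp]: "norm (cscale c u) = cmod c * norm u"
proof -
  have "(norm (cscale c u))\<^sup>2 = (cmod c * norm u)\<^sup>2"
    by (simp add: norm_ell2_sq power_mult_distrib cscale.rep_eq norm_mult infsum_cmult_right')
  then show ?thesis by (simp add: power2_eq_iff_nonneg)
qed

lemma bounded_linear_cscale: "bounded_linear (cscale c)"
proof (rule bounded_linear_intro[where K = "cmod c"])
  show "cscale c (u + v) = cscale c u + cscale c v" for u v :: "'a ell2"
    by transfer (simp add: algebra_simps)
  show "cscale c (r *\<^sub>R u) = r *\<^sub>R cscale c u" for r and u :: "'a ell2"
    by transfer (simp add: algebra_simps)
qed (simp add: mult.commute)

lemma cscale_cscale: "cscale a (cscale b u) = cscale (a * b) u"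
  by transfer (simp add: mult.assoc)

lemma cscale_one [simp]: "cscale 1 u = u"
  by transfer simp

lemma bounded_linear_coord: "bounded_linear (\<lambda>u. coord u x)"
  by (rule bounded_linear_intro[where K = 1])
    (simp_all add: plus_ell2.rep_eq scaleR_ell2.rep_eq cmod_coord_le scaleR_conv_of_real)

lift_definition cscale_op ::
    "complex \<Rightarrow> ('b::real_normed_vector \<Rightarrow>\<^sub>L 'a ell2) \<Rightarrow> ('b \<Rightarrow>\<^sub>L 'a ell2)"
  is "\<lambda>c T u. cscale c (T u)"
  by (rule bounded_linear_compose[OF bounded_linear_cscale])


section \<open>Orthogonal projections\<close>

definition orth_proj :: "'a ell2 set \<Rightarrow> 'a ell2 \<Rightarrow> 'a ell2" where
  "orth_proj S u = (THE v. v \<in> S \<and> (\<forall>z\<in>S. cinner (u - v) z = 0))"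

definition csubspace :: "'a ell2 set \<Rightarrow> bool" where
  "csubspace S \<longleftrightarrow> 0 \<in> S \<and> (\<forall>u\<in>S. \<forall>v\<in>S. u + v \<in> S) \<and> (\<forall>c. \<forall>u\<in>S. cscale c u \<in> S)"

lemma csubspaceD:
  assumes "csubspace S"
  shows "0 \<in> S" "u \<in> S \<Longrightarrow> v \<in> S \<Longrightarrow> u + v \<in> S" "u \<in> S \<Longrightarrow> cscale c u \<in> S"
    "u \<in> S \<Longrightarrow> r *\<^sub>R u \<in> S" "u \<in> S \<Longrightarrow> v \<in> S \<Longrightarrow> u - v \<in> S"
proof -
  show 1: "0 \<in> S" "u \<in> S \<Longrightarrow> v \<in> S \<Longrightarrow> u + v \<in> S" "u \<in> S \<Longrightarrow> cscale c u \<in> S" for u v c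
    using assms unfolding csubspace_def by blast+
  show 2: "u \<in> S \<Longrightarrow> r *\<^sub>R u \<in> S" for u r by (simp add: scaleR_cscale 1)
  show "u \<in> S \<Longrightarrow> v \<in> S \<Longrightarrow> u - v \<in> S" using 1(2)[of u "(-1) *\<^sub>R v"] 2[of v "-1"] by simp
qed

lemma orth_proj_exists:
  assumes S: "closed S" "csubspace S"
  shows "\<exists>v\<in>S. \<forall>z\<in>S. cinner (u - v) z = 0"
proof -
  define D where "D = (INF v\<in>S. (norm (u - v))\<^sup>2)"
  have ne: "S \<noteq> {}" using csubspaceD(1)[OF S(2)] by blast
  have bdd: "bdd_below ((\<lambda>v. (norm (u - v))\<^sup>2) ` S)" by (auto intro: bdd_belowI[of _ 0])
  have D: "D \<le> (norm (u - v))\<^sup>2" if "v \<in> S" for v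
    unfolding D_def by (rule cINF_lower[OF bdd that])
  have "\<exists>v\<in>S. (norm (u - v))\<^sup>2 < D + 1 / real (Suc n)" for n
    using cINF_less_iff[OF ne bdd, of "D + 1 / real (Suc n)"] by (simp add: D_def)
  then obtain y where yS: "\<And>n. y n \<in> S" and y: "\<And>n. (norm (u - y n))\<^sup>2 < D + 1 / real (Suc n)"
    by metis
  have para: "(norm (y m - y n))\<^sup>2 \<le> 2 / real (Suc m) + 2 / real (Suc n)" for m n
  proof -
    have "(norm (y m - y n))\<^sup>2 = 2 * (norm (u - y m))\<^sup>2 + 2 * (norm (u - y n))\<^sup>2
        - 4 * (norm (u - (1/2) *\<^sub>R (y m + y n)))\<^sup>2"
      by (simp add: power2_norm_eq_inner algebra_simps inner_commute)
    moreover have "D \<le> (norm (u - (1/2) *\<^sub>R (y m + y n)))\<^sup>2"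
      by (intro D csubspaceD[OF S(2)] yS)
    ultimately show ?thesis using y[of m] y[of n] by simp
  qed
  have "Cauchy y"
  proof (rule CauchyI)
    fix e :: real assume e: "e > 0"
    then obtain M where M: "inverse (real (Suc M)) < e\<^sup>2 / 4"
      using reals_Archimedean[of "e\<^sup>2 / 4"] by auto
    have "norm (y m - y n) < e" if "m \<ge> M" "n \<ge> M" for m n
    proof -
      have "2 / real (Suc k) \<le> 2 * inverse (real (Suc M))" if "k \<ge> M" for k
        using that by (simp add: field_simps)
      from this[OF that(1)] this[OF that(2)] have "(norm (y m - y n))\<^sup>2 < e\<^sup>2"
        using para[of m n] M by linarith
      then show ?thesis using e by (intro power_less_imp_less_base[of _ 2 e]) auto
    qed
    then show "\<exists>M. \<forall>m\<ge>M. \<forall>n\<ge>M. norm (y m - y n) < e" by blast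
  qed
  then obtain v where v: "y \<longlonglongrightarrow> v" using Cauchy_convergent convergentD by blast
  have vS: "v \<in> S" using closed_sequentially[OF S(1)] yS v by blast
  have "(norm (u - v))\<^sup>2 \<le> D + 0"
  proof (rule LIMSEQ_le)
    show "(\<lambda>n. (norm (u - y n))\<^sup>2) \<longlonglongrightarrow> (norm (u - v))\<^sup>2" by (intro tendsto_intros v)
    show "(\<lambda>n. D + 1 / real (Suc n)) \<longlonglongrightarrow> D + 0"
      by (intro tendsto_intros) (use LIMSEQ_inverse_real_of_nat in \<open>simp add: inverse_eq_divide\<close>)
  qed (use y in \<open>auto intro: less_imp_le\<close>)
  then have min: "(norm (u - v))\<^sup>2 \<le> (norm (u - z))\<^sup>2" if "z \<in> S" for z
    using D[OF that] by linarith
  have orth: "inner (u - v) z = 0" if z: "z \<in> S" for z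
  proof (cases "z = 0")
    case False
    define t where "t = inner (u - v) z / inner z z"
    have "inner z z > 0" using False by simp
    have "(norm (u - v))\<^sup>2 \<le> (norm (u - (v + t *\<^sub>R z)))\<^sup>2"
      by (intro min csubspaceD[OF S(2)] vS z)
    also have "\<dots> = (norm ((u - v) - t *\<^sub>R z))\<^sup>2" by (simp add: algebra_simps)
    also have "\<dots> = (norm (u - v))\<^sup>2 - 2 * t * inner (u - v) z + t * t * inner z z"
      by (simp add: power2_norm_eq_inner inner_diff_left inner_diff_right inner_commute)
    also have "\<dots> = (norm (u - v))\<^sup>2 - (inner (u - v) z)\<^sup>2 / inner z z"
      using \<open>inner z z > 0\<close> by (simp add: t_def power2_eq_square)
    finally have "(inner (u - v) z)\<^sup>2 / inner z z \<le> 0" by simp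
    then show ?thesis using \<open>inner z z > 0\<close> by (simp add: divide_le_0_iff)
  qed simp
  have "cinner (u - v) z = 0" if "z \<in> S" for z
    using orth[OF that] orth[OF csubspaceD(3)[OF S(2) that]]
    by (simp add: cinner_eq_inner complex_eq_iff)
  with vS show ?thesis by blast
qed

lemma orth_proj_unique:
  assumes S: "csubspace S" and v: "v \<in> S" "\<forall>z\<in>S. cinner (u - v) z = 0"
  shows "orth_proj S u = v"
  unfolding orth_proj_def
proof (rule the_equality)
  fix v' assume v': "v' \<in> S \<and> (\<forall>z\<in>S. cinner (u - v') z = 0)"
  then have "v - v' \<in> S" using csubspaceD(5)[OF S] v by blast
  then have "cinner (u - v') (v - v') = 0" "cinner (u - v) (v - v') = 0" using v v' by blast+
  then have "cinner ((u - v') - (u - v)) (v - v') = 0" by (simp only: cinner_diff_left[of "u - v'" "u - v"] diff_self)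
  then have "inner (v - v') (v - v') = 0" by (simp add: inner_ell2_def)
  then show "v' = v" by simp
qed (use v in blast)

lemma
  assumes "closed S" "csubspace S"
  shows orth_proj_in: "orth_proj S u \<in> S"
    and orth_proj_orth: "z \<in> S \<Longrightarrow> cinner (u - orth_proj S u) z = 0"
  using orth_proj_exists[OF assms, of u] orth_proj_unique[OF assms(2), of _ u] by auto

lemma orth_proj_id: "csubspace S \<Longrightarrow> u \<in> S \<Longrightarrow> orth_proj S u = u"
  by (rule orth_proj_unique) auto

lemma orth_proj_eq_0: "csubspace S \<Longrightarrow> (\<And>v. v \<in> S \<Longrightarrow> cinner u v = 0) \<Longrightarrow> orth_proj S u = 0"
  by (rule orth_proj_unique) (auto simp: csubspaceD)

lemma bounded_linear_orth_proj:
  assumes S: "closed S" "csubspace S"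
  shows "bounded_linear (orth_proj S)"
proof (rule bounded_linear_intro[where K = 1])
  note P = orth_proj_in[OF S] orth_proj_orth[OF S]
  show "orth_proj S (u + v) = orth_proj S u + orth_proj S v" for u v
  proof (intro orth_proj_unique S ballI csubspaceD[OF S(2)] P)
    fix z assume "z \<in> S"
    have "cinner (u + v - (orth_proj S u + orth_proj S v)) z
        = cinner ((u - orth_proj S u) + (v - orth_proj S v)) z" by (simp add: algebra_simps)
    then show "cinner (u + v - (orth_proj S u + orth_proj S v)) z = 0"
      using \<open>z \<in> S\<close> by (simp add: cinner_add_left P)
  qed
  show "orth_proj S (r *\<^sub>R u) = r *\<^sub>R orth_proj S u" for r u
  proof (intro orth_proj_unique S ballI csubspaceD[OF S(2)] P)
    fix z assume "z \<in> S"
    then show "cinner (r *\<^sub>R u - r *\<^sub>R orth_proj S u) z = 0"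
      using P(2)[of z u] by (simp add: cinner_diff_left cinner_scale_left scaleR_cscale)
  qed
  show "norm (orth_proj S u) \<le> norm u * 1" for u
  proof -
    have 0: "inner (u - orth_proj S u) (orth_proj S u) = 0"
      by (simp add: inner_ell2_def P)
    have "(norm u)\<^sup>2 = (norm ((u - orth_proj S u) + orth_proj S u))\<^sup>2" by simp
    also have "\<dots> = (norm (u - orth_proj S u))\<^sup>2 + (norm (orth_proj S u))\<^sup>2"
      using 0 by (simp only: power2_norm_eq_inner inner_add_left inner_add_right inner_commute)
    finally have "(norm (orth_proj S u))\<^sup>2 \<le> (norm u)\<^sup>2" by simp
    then show ?thesis by (simp add: power2_le_iff_abs_le)
  qed
qed

lemma orth_proj_cscale:
  assumes S: "closed S" "csubspace S"
  shows "orth_proj S (cscale c u) = cscale c (orth_proj S u)"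
proof (intro orth_proj_unique S ballI csubspaceD[OF S(2)] orth_proj_in[OF S])
  fix z assume "z \<in> S"
  then show "cinner (cscale c u - cscale c (orth_proj S u)) z = 0"
    using orth_proj_orth[OF S, of z u] by (simp add: cinner_diff_left cinner_scale_left)
qed


section \<open>The subproduct system of an ideal and its shift\<close>

text \<open>For a word \<open>w\<close> of length \<open>n\<close> the family \<open>ket w\<close>, with the single nonzero entry 1 at \<open>w\<close>, is the
  basis vector \<open>e\<^bsub>w\<^sub>1\<^esub> \<otimes> \<dots> \<otimes> e\<^bsub>w\<^sub>n\<^esub>\<close>. Thus \<open>(\<complex>\<^sup>d)\<^sup>\<otimes>\<^sup>n\<close> consists of the families supported on words of
  length \<open>n\<close>, the full Fock space is \<open>'d list ell2\<close>, and \<open>e\<^sub>i \<otimes> _\<close> prefixes the letter \<open>i\<close>. The sum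
  \<open>f(e) = \<Sum>\<^sub>w \<lambda>\<^sub>w e\<^bsub>w\<^sub>1\<^esub> \<otimes> \<dots> \<otimes> e\<^bsub>w\<^sub>n\<^esub>\<close> is \<open>poly_at_basis f\<close>, and \<open>X(n)\<close> is \<open>fiber I n\<close>.\<close>

lift_definition ket :: "'a \<Rightarrow> 'a ell2" is "\<lambda>w v. if v = w then 1 else 0"
proof -
  fix w :: 'a
  show "(\<lambda>v. (cmod (if v = w then 1 else 0))\<^sup>2) summable_on UNIV"
    by (rule sum_le_imp_sq_summable[where C = 1])
      (simp add: if_distrib[of cmod] if_distrib[of "\<lambda>x. x\<^sup>2"] sum.delta cong: if_cong)
qed

definition tensor_power :: "nat \<Rightarrow> 'd list ell2 set" where
  "tensor_power n = {u. \<forall>w. coord u w \<noteq> 0 \<longrightarrow> length w = n}"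

lift_definition component :: "nat \<Rightarrow> 'd list ell2 \<Rightarrow> 'd list ell2" is
  "\<lambda>n f w. if length w = n then f w else 0"
proof -
  fix n :: nat and f :: "'d list \<Rightarrow> complex"
  assume f: "(\<lambda>x. (cmod (f x))\<^sup>2) summable_on UNIV"
  show "(\<lambda>w. (cmod (if length w = n then f w else 0))\<^sup>2) summable_on UNIV"
    by (rule summable_on_comparison_test[OF f]) auto
qed

lift_definition tensor_left :: "'d \<Rightarrow> 'd list ell2 \<Rightarrow> 'd list ell2" is
  "\<lambda>i f w. case w of [] \<Rightarrow> 0 | j # v \<Rightarrow> if j = i then f v else 0"
proof -
  fix i :: 'd and f :: "'d list \<Rightarrow> complex"
  let ?g = "\<lambda>w. case w of [] \<Rightarrow> 0 | j # v \<Rightarrow> if j = i then f v else 0"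
  assume f: "(\<lambda>x. (cmod (f x))\<^sup>2) summable_on UNIV"
  have "((\<lambda>w. (cmod (?g w))\<^sup>2) \<circ> (#) i) summable_on UNIV" using f by (simp add: o_def)
  then have "(\<lambda>w. (cmod (?g w))\<^sup>2) summable_on range ((#) i)"
    by (subst summable_on_reindex) auto
  then show "(\<lambda>w. (cmod (?g w))\<^sup>2) summable_on UNIV"
    by (rule summable_on_cong_neutral[THEN iffD1, rotated -1]) (auto split: list.splits)
qed

definition poly_at_basis :: "'d ncpoly \<Rightarrow> 'd list ell2" where
  "poly_at_basis f = (\<Sum>w\<in>Poly_Mapping.keys f. cscale (Poly_Mapping.lookup f w) (ket w))"

definition fiber :: "'d ncpoly set \<Rightarrow> nat \<Rightarrow> 'd list ell2 set" where
  "fiber I n = {u \<in> tensor_power n. \<forall>f\<in>I. homogeneous_poly n f \<longrightarrow> cinner u (poly_at_basis f) = 0}"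

definition fock :: "'d ncpoly set \<Rightarrow> 'd list ell2 set" where
  "fock I = {u. \<forall>n. component n u \<in> fiber I n}"

text \<open>An operator on \<open>fock I\<close> is represented by its extension by zero to the orthogonal complement
  of \<open>fock I\<close>. This preserves sums, products, scalar multiples and norms, and
  turns the identity of \<open>fock I\<close> into the orthogonal projection onto \<open>fock I\<close>, which is therefore the
  unit of the tensor algebra below.\<close>

definition fock_id :: "'d ncpoly set \<Rightarrow> 'd list ell2 \<Rightarrow>\<^sub>L 'd list ell2" where
  "fock_id I = Blinfun (orth_proj (fock I))"

definition shift :: "'d ncpoly set \<Rightarrow> 'd \<Rightarrow> 'd list ell2 \<Rightarrow>\<^sub>L 'd list ell2" where
  "shift I i = (THE T.
     (\<forall>n. \<forall>u\<in>fiber I n. blinfun_apply T u = orth_proj (fiber I (Suc n)) (tensor_left i u)) \<and>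
     (\<forall>u. (\<forall>v\<in>fock I. cinner u v = 0) \<longrightarrow> blinfun_apply T u = 0))"


subsection \<open>Existence and uniqueness of the shift\<close>

lemma cinner_ket_right: "cinner u (ket w) = coord u w"
proof -
  have "cinner u (ket w) = (\<Sum>\<^sub>\<infinity>x. coord u x * cnj (if x = w then 1 else 0))"
    by (simp add: cinner.rep_eq ket.rep_eq)
  also have "\<dots> = (\<Sum>\<^sub>\<infinity>x\<in>{w}. coord u x)" by (rule infsum_cong_neutral) auto
  finally show ?thesis by simp
qed

lemma cinner_sum_right: "cinner u (\<Sum>x\<in>A. g x) = (\<Sum>x\<in>A. cinner u (g x))"
proof (induction A rule: infinite_finite_induct)
  case (insert x F)
  have "cinner u (v + w) = cinner u v + cinner u w" for v w
    by (metis cinner_add_left cinner_commute complex_cnj_add)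
  with insert show ?case by simp
qed (metis cinner_zero_left cinner_commute complex_cnj_zero sum.infinite sum.empty)+

lemma cinner_poly_at_basis:
  "cinner u (poly_at_basis f)
     = (\<Sum>w\<in>Poly_Mapping.keys f. cnj (Poly_Mapping.lookup f w) * coord u w)"
  by (simp add: poly_at_basis_def cinner_sum_right cinner_cscale_right cinner_ket_right)

lemma cinner_poly_component:
  "homogeneous_poly n f \<Longrightarrow> cinner (component n u) (poly_at_basis f) = cinner u (poly_at_basis f)"
  unfolding cinner_poly_at_basis
  by (intro sum.cong) (auto simp: homogeneous_poly_def component.rep_eq)

lemma component_in_tensor_power: "component n u \<in> tensor_power n"
  by (auto simp: tensor_power_def component.rep_eq split: if_splits)

lemma fock_iff:
  "u \<in> fock I \<longleftrightarrow> (\<forall>n. \<forall>f\<in>I. homogeneous_poly n f \<longrightarrow> cinner u (poly_at_basis f) = 0)"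
  by (auto simp: fock_def fiber_def component_in_tensor_power cinner_poly_component)

lemma fiber_eq: "fiber I n = fock I \<inter> tensor_power n"
proof (intro set_eqI iffI)
  fix u assume u: "u \<in> fiber I n"
  have "component m u = (if m = n then u else 0)" for m
    using u by (intro ell2_eqI)
      (auto simp: fiber_def tensor_power_def component.rep_eq zero_ell2.rep_eq)
  moreover have "0 \<in> fiber I m" for m
    by (auto simp: fiber_def tensor_power_def zero_ell2.rep_eq)
  ultimately show "u \<in> fock I \<inter> tensor_power n"
    using u by (auto simp: fock_def fiber_def[of I n])
qed (auto simp: fiber_def fock_iff)

lemma closed_coord_eq: "closed {u :: 'a ell2. coord u x = 0}"
  by (intro closed_Collect_eq continuous_intros
      linear_continuous_on[OF bounded_linear_coord])

lemma closed_cinner_eq: "closed {u :: 'a ell2. cinner u v = 0}"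
proof (intro closed_Collect_eq continuous_intros)
  show "continuous_on UNIV (\<lambda>u. cinner u v)"
    unfolding continuous_on_def by (auto intro!: tendsto_cinner_left tendsto_ident_at)
qed

lemma closed_fock: "closed (fock I)"
proof -
  have eq: "fock I = (\<Inter>f\<in>{f\<in>I. \<exists>n. homogeneous_poly n f}. {u. cinner u (poly_at_basis f) = 0})"
    by (simp add: set_eq_iff fock_iff) blast
  show ?thesis unfolding eq by (intro closed_INT ballI closed_cinner_eq)
qed

lemma csubspace_fock: "csubspace (fock I)"
  by (auto simp: csubspace_def fock_iff cinner_add_left cinner_scale_left)

lemma closed_tensor_power: "closed (tensor_power n)"
proof -
  have eq: "tensor_power n = (\<Inter>w\<in>{w. length w \<noteq> n}. {u. coord u w = 0})"
    by (auto simp: tensor_power_def)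
  show ?thesis unfolding eq by (intro closed_INT ballI closed_coord_eq)
qed

lemma csubspace_fiber: "csubspace (fiber I n)"
proof -
  have "csubspace (tensor_power n)"
    by (auto simp: csubspace_def tensor_power_def zero_ell2.rep_eq cscale.rep_eq plus_ell2.rep_eq)
      (metis add.right_neutral)
  then show ?thesis using csubspace_fock[of I] by (auto simp: csubspace_def fiber_eq)
qed

lemma closed_fiber: "closed (fiber I n)"
  unfolding fiber_eq by (intro closed_Int closed_fock closed_tensor_power)

lemmas proj_fock = orth_proj_in[OF closed_fock csubspace_fock]
  orth_proj_orth[OF closed_fock csubspace_fock]
  orth_proj_id[OF csubspace_fock]

lemma fock_id_apply: "blinfun_apply (fock_id I) = orth_proj (fock I)"
  unfolding fock_id_def
  by (intro bounded_linear_Blinfun_apply bounded_linear_orth_proj closed_fock csubspace_fock)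

lemma norm_tensor_left: "norm (tensor_left i u) = norm u"
proof -
  have "(\<Sum>\<^sub>\<infinity>w. (cmod (coord (tensor_left i u) w))\<^sup>2)
      = (\<Sum>\<^sub>\<infinity>w\<in>range ((#) i). (cmod (coord (tensor_left i u) w))\<^sup>2)"
    by (rule infsum_cong_neutral) (auto simp: tensor_left.rep_eq split: list.splits)
  also have "\<dots> = (\<Sum>\<^sub>\<infinity>w. (cmod (coord u w))\<^sup>2)"
    by (subst infsum_reindex) (auto simp: o_def tensor_left.rep_eq)
  finally have "(norm (tensor_left i u))\<^sup>2 = (norm u)\<^sup>2" by (simp add: norm_ell2_sq)
  then show ?thesis by (simp add: power2_eq_iff_nonneg)
qed

lemma bounded_linear_tensor_left: "bounded_linear (tensor_left i)"
proof (rule bounded_linear_intro[where K = 1])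
  show "tensor_left i (u + v) = tensor_left i u + tensor_left i v" for u v
    by transfer (auto simp: fun_eq_iff split: list.splits)
  show "tensor_left i (r *\<^sub>R u) = r *\<^sub>R tensor_left i u" for r u
    by transfer (auto simp: fun_eq_iff split: list.splits)
qed (simp add: norm_tensor_left)

lemma tensor_left_power: "u \<in> tensor_power n \<Longrightarrow> tensor_left i u \<in> tensor_power (Suc n)"
  by (auto simp: tensor_power_def tensor_left.rep_eq split: list.splits if_splits)

lemma cinner_component:
  "u \<in> tensor_power n \<Longrightarrow> cinner u (component n v) = cinner u v"
  unfolding cinner.rep_eq
  by (rule infsum_cong) (auto simp: tensor_power_def component.rep_eq)

lemma tensor_power_diff: "u \<in> tensor_power n \<Longrightarrow> v \<in> tensor_power n \<Longrightarrow> u - v \<in> tensor_power n"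
  by (auto simp: tensor_power_def minus_ell2.rep_eq) metis

lemma orth_proj_fock_homogeneous:
  assumes "u \<in> tensor_power n"
  shows "orth_proj (fock I) u = orth_proj (fiber I n) u"
proof (rule orth_proj_unique[OF csubspace_fock])
  have *: "orth_proj (fiber I n) u \<in> fiber I n"
    by (rule orth_proj_in[OF closed_fiber csubspace_fiber])
  then show "orth_proj (fiber I n) u \<in> fock I" by (simp add: fiber_eq)
  have 1: "u - orth_proj (fiber I n) u \<in> tensor_power n"
    using * assms by (intro tensor_power_diff) (auto simp: fiber_eq)
  show "\<forall>z\<in>fock I. cinner (u - orth_proj (fiber I n) u) z = 0"
  proof
    fix z assume "z \<in> fock I"
    then have "component n z \<in> fiber I n" by (simp add: fock_def)
    then have "cinner (u - orth_proj (fiber I n) u) (component n z) = 0"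
      by (rule orth_proj_orth[OF closed_fiber csubspace_fiber])
    then show "cinner (u - orth_proj (fiber I n) u) z = 0" by (simp add: cinner_component[OF 1])
  qed
qed

lemma component_sums: "(\<lambda>n. component n u) sums u"
  unfolding sums_def
proof (rule LIMSEQ_I)
  fix e :: real assume e: "e > 0"
  let ?f = "\<lambda>w. (cmod (coord u w))\<^sup>2"
  have summ: "?f summable_on UNIV" using coord[of u] by simp
  obtain F where F: "finite F" "(\<Sum>\<^sub>\<infinity>w. ?f w) - e\<^sup>2 / 2 < sum ?f F"
  proof -
    have "(sum ?f \<longlongrightarrow> (\<Sum>\<^sub>\<infinity>w. ?f w)) (finite_subsets_at_top UNIV)"
      using summ by (rule infsum_tendsto)
    then have "\<forall>\<^sub>F F in finite_subsets_at_top UNIV. (\<Sum>\<^sub>\<infinity>w. ?f w) - e\<^sup>2 / 2 < sum ?f F"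
      using e by (intro order_tendstoD) auto
    then show ?thesis using that by (auto simp: eventually_finite_subsets_at_top)
  qed
  have coords: "coord (u - (\<Sum>k<n. component k u)) w = (if length w < n then 0 else coord u w)" for n w
  proof -
    have "coord (\<Sum>k<n. component k u) w = (\<Sum>k<n. coord (component k u) w)"
      by (rule linear_sum[OF bounded_linear.linear[OF bounded_linear_coord]])
    also have "\<dots> = (if length w < n then coord u w else 0)"
      by (simp add: component.rep_eq)
    finally show ?thesis by (simp add: minus_ell2.rep_eq)
  qed
  have "norm ((\<Sum>k<n. component k u) - u) < e" if n: "n \<ge> Suc (\<Sum>w\<in>F. length w)" for n
  proof -
    have len: "length w < n" if "w \<in> F" for w
      using member_le_sum[of w F length] F(1) that n by force
    have "norm (u - (\<Sum>k<n. component k u)) \<le> sqrt (e\<^sup>2 / 2)"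
    proof (rule norm_ell2_leI)
      fix G :: "'a list set" assume G: "finite G"
      have "(\<Sum>w\<in>G. (cmod (coord (u - (\<Sum>k<n. component k u)) w))\<^sup>2)
          = (\<Sum>w\<in>G - F. (cmod (coord (u - (\<Sum>k<n. component k u)) w))\<^sup>2)"
        unfolding coords by (rule sum.mono_neutral_right) (auto simp: G len)
      also have "\<dots> \<le> (\<Sum>w\<in>G - F. ?f w)"
        unfolding coords by (rule sum_mono) auto
      also have "\<dots> = sum ?f (G \<union> F) - sum ?f F"
        using sum.subset_diff[of F "G \<union> F" ?f] G F by (simp add: Un_Diff)
      also have "sum ?f (G \<union> F) \<le> (\<Sum>\<^sub>\<infinity>w. ?f w)"
        using summ G F by (intro finite_sum_le_infsum) auto
      finally show "(\<Sum>w\<in>G. (cmod (coord (u - (\<Sum>k<n. component k u)) w))\<^sup>2) \<le> (sqrt (e\<^sup>2 / 2))\<^sup>2"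
        using F(2) by simp
    qed simp
    also have "\<dots> < e" using e by (intro real_less_lsqrt) auto
    finally show ?thesis by (simp add: norm_minus_commute)
  qed
  then show "\<exists>no. \<forall>n\<ge>no. norm ((\<Sum>k<n. component k u) - u) < e" by blast
qed

lemma shift_ex1:
  "\<exists>!T. (\<forall>n. \<forall>u\<in>fiber I n. blinfun_apply T u = orth_proj (fiber I (Suc n)) (tensor_left i u)) \<and>
        (\<forall>u. (\<forall>v\<in>fock I. cinner u v = 0) \<longrightarrow> blinfun_apply T u = 0)"
    (is "\<exists>!T. ?P T")
  and shift_eq: "shift I i = fock_id I o\<^sub>L Blinfun (tensor_left i) o\<^sub>L fock_id I" (is "_ = ?T")
proof -
  have ap: "blinfun_apply ?T u = orth_proj (fock I) (tensor_left i (orth_proj (fock I) u))" for u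
    by (simp add: fock_id_apply bounded_linear_Blinfun_apply[OF bounded_linear_tensor_left])
  have ex: "?P ?T"
  proof (intro conjI allI ballI impI)
    fix n u assume "u \<in> fiber I n"
    then have "u \<in> fock I" "tensor_left i u \<in> tensor_power (Suc n)"
      by (auto simp: fiber_eq tensor_left_power)
    then show "blinfun_apply ?T u = orth_proj (fiber I (Suc n)) (tensor_left i u)"
      unfolding ap by (simp add: proj_fock orth_proj_fock_homogeneous)
  next
    fix u assume "\<forall>v\<in>fock I. cinner u v = 0"
    then have "orth_proj (fock I) u = 0" by (intro orth_proj_eq_0 csubspace_fock) blast
    then show "blinfun_apply ?T u = 0"
      unfolding ap
      by (simp add: bounded_linear.linear[OF bounded_linear_tensor_left, THEN linear_0] proj_fock
          csubspaceD(1)[OF csubspace_fock])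
  qed
  have un: "T = T'" if T: "?P T" "?P T'" for T T'
  proof (rule blinfun_eqI)
    fix u
    let ?v = "orth_proj (fock I) u"
    have "component n ?v \<in> fiber I n" for n using proj_fock(1)[of I u] by (simp add: fock_def)
    then have 0: "blinfun_apply T (component n ?v) = blinfun_apply T' (component n ?v)" for n
      using T(1)[THEN conjunct1, rule_format, of "component n ?v" n]
        T(2)[THEN conjunct1, rule_format, of "component n ?v" n] by simp
    have sums: "(\<lambda>n. blinfun_apply T (component n ?v)) sums blinfun_apply T ?v" for T :: "'a list ell2 \<Rightarrow>\<^sub>L 'a list ell2"
      by (intro bounded_linear.sums[OF blinfun.bounded_linear_right] component_sums)
    have 1: "blinfun_apply T ?v = blinfun_apply T' ?v"
      using sums[of T] sums[of T'] unfolding 0 by (rule sums_unique2)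
    have "\<forall>v\<in>fock I. cinner (u - ?v) v = 0" using proj_fock(2) by blast
    then have "blinfun_apply T (u - ?v) = 0" "blinfun_apply T' (u - ?v) = 0" using T by blast+
    with 1 show "blinfun_apply T u = blinfun_apply T' u" by (simp add: blinfun.diff_right)
  qed
  show "\<exists>!T. ?P T" using ex un by blast
  show "shift I i = ?T" unfolding shift_def
    by (rule the_equality, rule ex) (rule un, assumption, rule ex)
qed


section \<open>The tensor algebra, its characters and isomorphisms\<close>

text \<open>\<open>\<Rightarrow>\<^sub>L\<close> only requires real linearity. The elements of a tensor algebra are nevertheless complex
  linear, since the complex linear operators form a closed subalgebra. Complex homogeneity of
  characters and isomorphisms is required explicitly.\<close>

definition unital_subalgebra ::
    "('a ell2 \<Rightarrow>\<^sub>L 'a ell2) \<Rightarrow> ('a ell2 \<Rightarrow>\<^sub>L 'a ell2) set \<Rightarrow> bool" where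
  "unital_subalgebra e A \<longleftrightarrow>
     e \<in> A \<and> (\<forall>a\<in>A. \<forall>b\<in>A. a + b \<in> A \<and> a o\<^sub>L b \<in> A) \<and> (\<forall>c. \<forall>a\<in>A. cscale_op c a \<in> A)"

definition tensor_algebra :: "'d ncpoly set \<Rightarrow> ('d list ell2 \<Rightarrow>\<^sub>L 'd list ell2) set" where
  "tensor_algebra I = (\<lambda>A. closed A \<and> unital_subalgebra (fock_id I) A) hull range (shift I)"

definition character :: "'d ncpoly set \<Rightarrow> (('d list ell2 \<Rightarrow>\<^sub>L 'd list ell2) \<Rightarrow> complex) \<Rightarrow> bool" where
  "character I \<rho> \<longleftrightarrow>
     (\<exists>a\<in>tensor_algebra I. \<rho> a \<noteq> 0) \<and>
     (\<forall>a\<in>tensor_algebra I. \<forall>b\<in>tensor_algebra I. \<rho> (a + b) = \<rho> a + \<rho> b \<and> \<rho> (a o\<^sub>L b) = \<rho> a * \<rho> b) \<and>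
     (\<forall>c. \<forall>a\<in>tensor_algebra I. \<rho> (cscale_op c a) = c * \<rho> a)"

definition vacuum_character :: "'d ncpoly set \<Rightarrow> ('d list ell2 \<Rightarrow>\<^sub>L 'd list ell2) \<Rightarrow> complex" where
  "vacuum_character I = (THE \<rho>. \<rho> \<in> extensional (tensor_algebra I) \<and> character I \<rho> \<and>
     (\<forall>i. \<rho> (shift I i) = 0))"

definition algebraic_isomorphism ::
    "'d ncpoly set \<Rightarrow> 'e ncpoly set \<Rightarrow>
     (('d list ell2 \<Rightarrow>\<^sub>L 'd list ell2) \<Rightarrow> ('e list ell2 \<Rightarrow>\<^sub>L 'e list ell2)) \<Rightarrow> bool" where
  "algebraic_isomorphism I J \<phi> \<longleftrightarrow>
     bij_betw \<phi> (tensor_algebra I) (tensor_algebra J) \<and>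
     (\<forall>a\<in>tensor_algebra I. \<forall>b\<in>tensor_algebra I.
        \<phi> (a + b) = \<phi> a + \<phi> b \<and> \<phi> (a o\<^sub>L b) = \<phi> a o\<^sub>L \<phi> b) \<and>
     (\<forall>c. \<forall>a\<in>tensor_algebra I. \<phi> (cscale_op c a) = cscale_op c (\<phi> a))"

text \<open>The inverse of a bounded isomorphism is bounded by the open mapping theorem, as tensor algebras
  are complete.\<close>

definition bounded_isomorphism ::
    "'d ncpoly set \<Rightarrow> 'e ncpoly set \<Rightarrow>
     (('d list ell2 \<Rightarrow>\<^sub>L 'd list ell2) \<Rightarrow> ('e list ell2 \<Rightarrow>\<^sub>L 'e list ell2)) \<Rightarrow> bool" where
  "bounded_isomorphism I J \<phi> \<longleftrightarrow>
     algebraic_isomorphism I J \<phi> \<and> (\<exists>C. \<forall>a\<in>tensor_algebra I. norm (\<phi> a) \<le> C * norm a)"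

definition isometric_isomorphism ::
    "'d ncpoly set \<Rightarrow> 'e ncpoly set \<Rightarrow>
     (('d list ell2 \<Rightarrow>\<^sub>L 'd list ell2) \<Rightarrow> ('e list ell2 \<Rightarrow>\<^sub>L 'e list ell2)) \<Rightarrow> bool" where
  "isometric_isomorphism I J \<phi> \<longleftrightarrow>
     algebraic_isomorphism I J \<phi> \<and> (\<forall>a\<in>tensor_algebra I. norm (\<phi> a) = norm a)"

definition vacuum_preserving ::
    "'d ncpoly set \<Rightarrow> 'e ncpoly set \<Rightarrow>
     (('d list ell2 \<Rightarrow>\<^sub>L 'd list ell2) \<Rightarrow> ('e list ell2 \<Rightarrow>\<^sub>L 'e list ell2)) \<Rightarrow> bool" where
  "vacuum_preserving I J \<phi> \<longleftrightarrow>
     (\<forall>a\<in>tensor_algebra I. vacuum_character J (\<phi> a) = vacuum_character I a)"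


subsection \<open>Existence and uniqueness of the vacuum character\<close>

lemma closed_subalgebra_tensor_algebra:
  "closed (tensor_algebra I) \<and> unital_subalgebra (fock_id I) (tensor_algebra I)"
  unfolding tensor_algebra_def
proof (rule hull_in)
  fix \<A> assume "\<forall>A\<in>\<A>. closed A \<and> unital_subalgebra (fock_id I) A"
  then show "closed (\<Inter>\<A>) \<and> unital_subalgebra (fock_id I) (\<Inter>\<A>)"
    unfolding unital_subalgebra_def by (intro conjI closed_Inter) auto
qed

lemma shift_in_tensor_algebra: "shift I i \<in> tensor_algebra I"
  unfolding tensor_algebra_def by (rule hull_inc) simp

lemmas tensor_algebra_closed = closed_subalgebra_tensor_algebra[THEN conjunct1]

lemma tensor_algebra_ops:
  "fock_id I \<in> tensor_algebra I"
  "a \<in> tensor_algebra I \<Longrightarrow> b \<in> tensor_algebra I \<Longrightarrow> a + b \<in> tensor_algebra I"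
  "a \<in> tensor_algebra I \<Longrightarrow> b \<in> tensor_algebra I \<Longrightarrow> a o\<^sub>L b \<in> tensor_algebra I"
  "a \<in> tensor_algebra I \<Longrightarrow> cscale_op c a \<in> tensor_algebra I"
  using closed_subalgebra_tensor_algebra[of I] by (auto simp: unital_subalgebra_def)

lemma tensor_algebra_induct [consumes 1, case_names closed id shift add mult scale]:
  assumes "a \<in> tensor_algebra I"
    and "closed {a \<in> tensor_algebra I. P a}"
    and "P (fock_id I)" "\<And>i. P (shift I i)"
    and "\<And>a b. a \<in> tensor_algebra I \<Longrightarrow> b \<in> tensor_algebra I \<Longrightarrow> P a \<Longrightarrow> P b \<Longrightarrow> P (a + b)"
    and "\<And>a b. a \<in> tensor_algebra I \<Longrightarrow> b \<in> tensor_algebra I \<Longrightarrow> P a \<Longrightarrow> P b \<Longrightarrow> P (a o\<^sub>L b)"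
    and "\<And>c a. a \<in> tensor_algebra I \<Longrightarrow> P a \<Longrightarrow> P (cscale_op c a)"
  shows "P a"
proof -
  have "tensor_algebra I \<subseteq> {a \<in> tensor_algebra I. P a}"
    unfolding tensor_algebra_def[of I]
    by (rule hull_minimal, unfold tensor_algebra_def[of I, symmetric])
      (auto simp: unital_subalgebra_def assms tensor_algebra_ops shift_in_tensor_algebra)
  then show ?thesis using assms(1) by blast
qed

lemma norm_cscale_op: "norm (cscale_op c a) = cmod c * norm a"
proof -
  have le: "norm (cscale_op c a) \<le> cmod c * norm a" for c and a :: "'a::real_normed_vector \<Rightarrow>\<^sub>L 'b ell2"
  proof (rule norm_blinfun_bound)
    fix x
    have "cmod c * norm (blinfun_apply a x) \<le> cmod c * (norm a * norm x)"
      by (intro mult_left_mono norm_blinfun) auto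
    then show "norm (blinfun_apply (cscale_op c a) x) \<le> cmod c * norm a * norm x"
      by (simp add: cscale_op.rep_eq mult.assoc)
  qed simp
  show ?thesis
  proof (cases "c = 0")
    case True
    then show ?thesis using le[of 0 a] by simp
  next
    case False
    have "cscale_op (inverse c) (cscale_op c a) = a"
      using False by (intro blinfun_eqI) (simp add: cscale_op.rep_eq cscale_cscale)
    then have "norm a \<le> cmod (inverse c) * norm (cscale_op c a)"
      using le[of "inverse c" "cscale_op c a"] by simp
    then have "cmod c * norm a \<le> norm (cscale_op c a)"
      using False by (simp add: norm_inverse norm_divide field_simps)
    with le[of c a] show ?thesis by simp
  qed
qed

lemma zero_in_tensor_algebra: "0 \<in> tensor_algebra I"
proof -
  have "cscale_op 0 (fock_id I) = 0"
    using norm_cscale_op[of 0 "fock_id I"] by simp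
  then show ?thesis using tensor_algebra_ops(4)[OF tensor_algebra_ops(1), of 0 I] by simp
qed

lemma character_norm_le:
  assumes \<rho>: "character I \<rho>" and a: "a \<in> tensor_algebra I"
  shows "cmod (\<rho> a) \<le> norm a"
proof (rule ccontr)
  assume less: "\<not> cmod (\<rho> a) \<le> norm a"
  then have nz: "\<rho> a \<noteq> 0" by auto
  define x where "x = cscale_op (inverse (\<rho> a)) a"
  have x: "x \<in> tensor_algebra I" unfolding x_def by (intro tensor_algebra_ops a)
  have \<rho>x: "\<rho> x = 1" using \<rho> a nz by (simp add: x_def character_def)
  have nx: "norm x < 1" using less nz by (simp add: x_def norm_cscale_op norm_inverse norm_divide field_simps)
  define p where "p n = ((o\<^sub>L) x ^^ n) x" for n
  have pin: "p n \<in> tensor_algebra I" for n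
    by (induction n) (auto simp: p_def x intro: tensor_algebra_ops)
  have np: "norm (p n) \<le> norm x ^ Suc n" for n
  proof (induction n)
    case (Suc n)
    have "norm (p (Suc n)) \<le> norm x * norm (p n)"
      by (simp add: p_def norm_blinfun_compose)
    also have "\<dots> \<le> norm x * norm x ^ Suc n" by (intro mult_left_mono Suc) auto
    finally show ?case by simp
  qed (simp add: p_def)
  have summ: "summable p"
  proof (rule summable_comparison_test')
    show "summable (\<lambda>n. norm x ^ Suc n)" using nx by (simp add: summable_geometric)
  qed (rule np)
  define s where "s = suminf p"
  have part: "(\<Sum>k<n. p k) \<in> tensor_algebra I" for n
    by (induction n) (auto simp: zero_in_tensor_algebra pin intro: tensor_algebra_ops)
  have s: "s \<in> tensor_algebra I"
    unfolding s_def
    by (rule closed_sequentially[OF tensor_algebra_closed part summable_LIMSEQ[OF summ]])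
  have "s = p 0 + suminf (\<lambda>n. p (Suc n))" unfolding s_def using suminf_split_head[OF summ] by simp
  also have "suminf (\<lambda>n. p (Suc n)) = suminf (\<lambda>n. x o\<^sub>L p n)" by (simp add: p_def)
  also have "\<dots> = x o\<^sub>L s"
    unfolding s_def
    by (rule bounded_linear.suminf[OF bounded_bilinear.bounded_linear_right[OF
          bounded_bilinear_blinfun_compose] summ, symmetric])
  finally have "s = x + (x o\<^sub>L s)" by (simp add: p_def)
  then have "\<rho> s = \<rho> (x + (x o\<^sub>L s))" by simp
  also have "\<dots> = \<rho> x + \<rho> x * \<rho> s"
    using \<rho> x s tensor_algebra_ops(3)[OF x s] by (simp add: character_def)
  finally show False by (simp add: \<rho>x)
qed

lemma character_fock_id:
  assumes "character I \<rho>" shows "\<rho> (fock_id I) = 1"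
proof -
  obtain a where a: "a \<in> tensor_algebra I" "\<rho> a \<noteq> 0" using assms by (auto simp: character_def)
  have iff: "a o\<^sub>L fock_id I = a
      \<longleftrightarrow> (\<forall>u. blinfun_apply a (orth_proj (fock I) u) = blinfun_apply a u)"
    for a :: "'a list ell2 \<Rightarrow>\<^sub>L 'a list ell2"
    by (simp add: blinfun_apply_inject[symmetric] fun_eq_iff fock_id_apply)
  have "a o\<^sub>L fock_id I = a"
    using a(1)
  proof (induction rule: tensor_algebra_induct)
    case closed
    have "{a \<in> tensor_algebra I. a o\<^sub>L fock_id I = a}
        = tensor_algebra I \<inter> {a. a o\<^sub>L fock_id I = a}" by blast
    also have "closed \<dots>"
      by (intro closed_Int tensor_algebra_closed closed_Collect_eq continuous_on_id
          linear_continuous_on bounded_bilinear.bounded_linear_left[OF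
            bounded_bilinear_blinfun_compose])
    finally show ?case .
  qed (simp_all add: iff shift_eq fock_id_apply proj_fock blinfun.add_left cscale_op.rep_eq)
  then have "\<rho> a = \<rho> a * \<rho> (fock_id I)"
    using assms a(1) tensor_algebra_ops(1)[of I] unfolding character_def by metis
  then show ?thesis using a(2) by simp
qed

lemma vacuum_vector_in_fock:
  assumes I: "homogeneous_ideal I" shows "ket [] \<in> fock I"
  unfolding fock_iff
proof (intro allI ballI impI)
  fix n f assume f: "f \<in> I" "homogeneous_poly n f"
  have ideal: "two_sided_ideal I"
  proof -
    obtain S where "I = two_sided_ideal hull S" using I by (auto simp: homogeneous_ideal_def)
    moreover have "two_sided_ideal (two_sided_ideal hull S)"
      by (rule hull_in) (auto simp: two_sided_ideal_def)
    ultimately show ?thesis by simp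
  qed
  have "Poly_Mapping.lookup f [] = 0"
  proof (rule ccontr)
    assume nz: "Poly_Mapping.lookup f [] \<noteq> 0"
    then have "n = 0" using f(2) by (auto simp: homogeneous_poly_def in_keys_iff)
    then have "Poly_Mapping.lookup f w = 0" if "w \<noteq> []" for w
      using f(2) that by (auto simp: homogeneous_poly_def in_keys_iff)
    then have f_eq: "f = Poly_Mapping.single 0 (Poly_Mapping.lookup f [])"
      by (intro poly_mapping_eqI) (simp add: lookup_single when_def zero_list_def)
    have "f * Poly_Mapping.single 0 (inverse (Poly_Mapping.lookup f [])) = 1"
      by (subst f_eq, subst mult_single) (simp add: nz)
    moreover have mult: "g * r \<in> I" if "g \<in> I" for g r
      using ideal that by (simp add: two_sided_ideal_def)
    ultimately have "1 \<in> I" using f(1) by metis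
    then have "r \<in> I" for r using mult[of 1 r] by simp
    then show False using I by (auto simp: homogeneous_ideal_def)
  qed
  then show "cinner (ket []) (poly_at_basis f) = 0"
    by (auto simp: cinner_poly_at_basis ket.rep_eq intro!: sum.neutral)
qed

lemma vacuum_character_ex1:
  assumes I: "homogeneous_ideal I"
  shows "\<exists>!\<rho>. \<rho> \<in> extensional (tensor_algebra I) \<and> character I \<rho> \<and> (\<forall>i. \<rho> (shift I i) = 0)"
proof -
  let ?\<Omega> = "ket [] :: 'a list ell2"
  define \<rho> where "\<rho> = (\<lambda>a\<in>tensor_algebra I. coord (blinfun_apply a ?\<Omega>) [])"
  have P: "coord (orth_proj (fock I) u) [] = coord u []" for u
    using proj_fock(2)[OF vacuum_vector_in_fock[OF I], of u]
    by (simp add: cinner_ket_right minus_ell2.rep_eq)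
  have S: "coord (blinfun_apply (shift I i) u) [] = 0" for i u
    by (simp add: shift_eq fock_id_apply P tensor_left.rep_eq
        bounded_linear_Blinfun_apply[OF bounded_linear_tensor_left])
  have key: "\<forall>u. coord (blinfun_apply a u) [] = coord u [] * coord (blinfun_apply a ?\<Omega>) []"
    if "a \<in> tensor_algebra I" for a
    using that
  proof (induction rule: tensor_algebra_induct)
    case closed
    have "{a \<in> tensor_algebra I. \<forall>u. coord (blinfun_apply a u) [] = coord u [] * coord (blinfun_apply a ?\<Omega>) []}
        = tensor_algebra I \<inter> (\<Inter>u. {a. coord (blinfun_apply a u) [] = coord u [] * coord (blinfun_apply a ?\<Omega>) []})"
      by blast
    also have "closed (tensor_algebra I \<inter> (\<Inter>u. {a. coord (blinfun_apply a u) []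
        = coord u [] * coord (blinfun_apply a ?\<Omega>) []}))"
    proof -
      have "continuous_on UNIV (\<lambda>a. coord (blinfun_apply a u) [])"
        for u :: "'a list ell2"
        by (rule linear_continuous_on[OF bounded_linear_compose[OF bounded_linear_coord
              blinfun.bounded_linear_left]])
      then show ?thesis
        by (intro closed_Int tensor_algebra_closed closed_INT ballI closed_Collect_eq
            continuous_on_mult continuous_on_const)
    qed
    finally show ?case .
  next
    case id
    show ?case by (simp add: fock_id_apply P ket.rep_eq)
  next
    case (mult a b)
    show ?case
    proof
      fix u
      have "coord (blinfun_apply (a o\<^sub>L b) v) []
          = coord v [] * coord (blinfun_apply b ?\<Omega>) [] * coord (blinfun_apply a ?\<Omega>) []" for v
        using mult.IH by (metis blinfun_apply_blinfun_compose)
      from this[of u] this[of ?\<Omega>]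
      show "coord (blinfun_apply (a o\<^sub>L b) u) [] = coord u [] * coord (blinfun_apply (a o\<^sub>L b) ?\<Omega>) []"
        by (simp add: ket.rep_eq)
    qed
  next
    case (add a b)
    show ?case
    proof
      fix u
      show "coord (blinfun_apply (a + b) u) [] = coord u [] * coord (blinfun_apply (a + b) ?\<Omega>) []"
        using add.IH[rule_format, of u] by (simp add: blinfun.add_left plus_ell2.rep_eq distrib_left)
    qed
  next
    case (scale c a)
    show ?case
    proof
      fix u
      show "coord (blinfun_apply (cscale_op c a) u) []
          = coord u [] * coord (blinfun_apply (cscale_op c a) ?\<Omega>) []"
        using scale.IH[rule_format, of u] by (simp add: cscale_op.rep_eq cscale.rep_eq)
    qed
  qed (simp add: S)
  have char: "character I \<rho>"
    unfolding character_def
  proof (intro conjI bexI ballI allI)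
    show "\<rho> (fock_id I) \<noteq> 0" "fock_id I \<in> tensor_algebra I"
      by (simp_all add: \<rho>_def tensor_algebra_ops fock_id_apply P ket.rep_eq)
    fix a b assume ab: "a \<in> tensor_algebra I" "b \<in> tensor_algebra I"
    then show "\<rho> (a + b) = \<rho> a + \<rho> b"
      by (simp add: \<rho>_def tensor_algebra_ops blinfun.add_left plus_ell2.rep_eq)
    show "\<rho> (a o\<^sub>L b) = \<rho> a * \<rho> b"
      using ab key[OF ab(1), rule_format, of "blinfun_apply b ?\<Omega>"]
      by (simp add: \<rho>_def tensor_algebra_ops)
    fix c show "\<rho> (cscale_op c a) = c * \<rho> a"
      using ab by (simp add: \<rho>_def tensor_algebra_ops cscale_op.rep_eq cscale.rep_eq)
  qed
  show ?thesis
  proof (rule ex1I[of _ \<rho>])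
    show "\<rho> \<in> extensional (tensor_algebra I) \<and> character I \<rho> \<and> (\<forall>i. \<rho> (shift I i) = 0)"
      using char by (simp add: \<rho>_def shift_in_tensor_algebra S)
    fix \<sigma> assume \<sigma>: "\<sigma> \<in> extensional (tensor_algebra I) \<and> character I \<sigma> \<and> (\<forall>i. \<sigma> (shift I i) = 0)"
    have lip: "cmod (\<tau> a - \<tau> b) \<le> norm (a - b)"
      if \<tau>: "character I \<tau>" and ab: "a \<in> tensor_algebra I" "b \<in> tensor_algebra I" for \<tau> a b
    proof -
      have "cscale_op (-1) b = - b"
        by (intro blinfun_eqI ell2_eqI)
          (simp add: cscale_op.rep_eq cscale.rep_eq blinfun.minus_left uminus_ell2.rep_eq)
      then have eq: "a - b = a + cscale_op (-1) b" by simp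
      have b': "cscale_op (-1) b \<in> tensor_algebra I" by (intro tensor_algebra_ops ab)
      have "\<tau> (a + cscale_op (-1) b) = \<tau> a - \<tau> b"
        using \<tau> ab b' by (simp add: character_def)
      then have "\<tau> (a - b) = \<tau> a - \<tau> b" "a - b \<in> tensor_algebra I"
        unfolding eq using tensor_algebra_ops(2)[OF ab(1) b'] by blast+
      then show ?thesis using character_norm_le[OF \<tau>, of "a - b"] by simp
    qed
    have cont: "continuous_on (tensor_algebra I) \<tau>" if "character I \<tau>" for \<tau>
      unfolding continuous_on_iff dist_norm using lip[OF that] by (metis le_less_trans)
    have "\<sigma> a = \<rho> a" if "a \<in> tensor_algebra I" for a
      using that
    proof (induction rule: tensor_algebra_induct)
      case closed
      have "closedin (top_of_set (tensor_algebra I)) {a \<in> tensor_algebra I. \<sigma> a - \<rho> a = 0}"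
        using \<sigma> char by (intro continuous_closedin_preimage_constant continuous_on_diff cont) auto
      then show ?case using tensor_algebra_closed[of I] by (auto dest: closedin_closed_trans)
    next
      case id
      show ?case using \<sigma> char by (simp add: character_fock_id)
    next
      case (shift i)
      show ?case using \<sigma> by (simp add: \<rho>_def shift_in_tensor_algebra S)
    next
      case (add a b)
      then show ?case using \<sigma> char by (simp add: character_def)
    next
      case (mult a b)
      then show ?case using \<sigma> char by (simp add: character_def)
    next
      case (scale c a)
      then show ?case using \<sigma> char by (simp add: character_def)
    qed
    then show "\<sigma> = \<rho>" using \<sigma> by (intro extensionalityI[of _ "tensor_algebra I"]) (auto simp: \<rho>_def)
  qed
qed

end

theory Submission
  imports Defs "HOL-Complex_Analysis.Conformal_Mappings"
begin

text \<open>A character \<open>\<rho>\<close> of the tensor algebra of \<open>I\<close> is determined by its point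
  \<open>z = (\<rho>(T\<^sub>1), \<dots>, \<rho>(T\<^sub>d))\<close>, which lies in the closed unit ball and in the common zero set of \<open>I\<close>, a
  complex cone. Conversely, each zero \<open>z\<close> in the open ball is the point of a character, namely
  \<open>a \<mapsto> \<langle>a \<Omega>, \<xi>\<^sub>z\<rangle>\<close> with \<open>\<Omega>\<close> the vacuum vector and \<open>\<xi>\<^sub>z = \<Sum>\<^sub>w cnj (z\<^sup>w) e\<^sub>w\<close>
  (\<open>character_evaluation\<close>). For fixed \<open>a\<close> this is a power series in \<open>l\<close> along every disc
  \<open>l \<mapsto> l z\<close>. Hence composition with an isomorphism \<open>\<phi>\<close> from the algebra of \<open>I\<close> to that of \<open>J\<close> carries
  the discs through the origin on the side of \<open>J\<close> to holomorphic discs in the closed ball on the side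
  of \<open>I\<close>.

  Let \<open>a\<close> be the point of \<open>\<rho>\<^sub>0 \<circ> \<phi>\<close> and \<open>b\<close> the point of \<open>\<rho>\<^sub>0 \<circ> \<phi>\<inverse>\<close>. If \<open>a = 0\<close> then \<open>\<phi>\<close> already
  preserves the vacuum. Otherwise \<open>b \<noteq> 0\<close>, and the maximum principle shows that \<open>a\<close> and \<open>b\<close> lie in
  the open ball (\<open>character_point_vacuum_less_1\<close>). The image of the disc through \<open>b\<close> is a holomorphic disc
  that takes the value \<open>a\<close> at \<open>0\<close> and the value \<open>0\<close> at \<open>\<bar>b\<bar>\<close>, so \<open>\<bar>a\<bar> \<le> \<bar>b\<bar>\<close> by the Schwarz lemma
  for ball-valued functions; by symmetry \<open>\<bar>a\<bar> = \<bar>b\<bar> = t\<close>, and the case of equality in the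
  Schwarz lemma says that the disc through \<open>b\<close> is mapped onto the disc through \<open>a\<close> by the involution
  \<open>m(l) = (t - l) / (1 - t l)\<close> (\<open>image_of_vacuum_disc\<close>).

  Within these two discs the vacuum can be moved back to the vacuum by rotations. The gauge
  automorphisms \<open>T\<^sub>i \<mapsto> c T\<^sub>i\<close>, \<open>\<bar>c\<bar> = 1\<close>, rotate all points. There is \<open>\<nu>\<close> on the unit circle with
  \<open>\<bar>m(\<nu> t)\<bar> = t\<close> (\<open>disc_swap_rotation\<close>). Rotating \<open>a\<close> by \<open>\<nu>\<close>, going back through \<open>\<phi>\<inverse>\<close>, rotating
  the result \<open>m(\<nu> t)\<close> to \<open>t\<close>, that is, to \<open>b\<close>, and applying \<open>\<phi>\<close> once more ends in \<open>0\<close>. Thus, for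
  suitable gauge automorphisms \<open>\<gamma>\<close> and \<open>\<gamma>'\<close>, the isomorphism \<open>\<phi>' = \<phi> \<circ> \<gamma>' \<circ> \<phi>\<inverse> \<circ> \<gamma> \<circ> \<phi>\<close> preserves the
  vacuum (\<open>vacuum_preserving_correction\<close>).

  Gauge automorphisms are isometric, being given by conjugation with unitary operators, so \<open>\<phi>'\<close> is
  algebraic or isometric whenever \<open>\<phi>\<close> is. In the bounded case this needs that \<open>\<phi>\<inverse>\<close> is bounded, which is
  the bounded inverse theorem (\<open>bounded_inverse\<close>).\<close>

section \<open>The Schwarz lemma for discs in the ball of a Hilbert space\<close>

lemma cmod_cinner_le: "cmod (cinner u v) \<le> norm u * norm v"
proof -
  \<comment> \<open>A phase that makes the inner product real, so that the real Cauchy--Schwarz inequality applies.\<close>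
  define c where "c = cnj (sgn (cinner u v))"
  have "c * cinner u v = complex_of_real (cmod (cinner u v))"
    by (simp add: c_def sgn_eq complex_norm_square[symmetric] power2_eq_square divide_simps mult.commute[of "cnj _"])
  then have "cmod (cinner u v) = inner (cscale c u) v"
    by (simp add: inner_ell2_def cinner_scale_left)
  also have "\<dots> \<le> norm (cscale c u) * norm v" by (rule norm_cauchy_schwarz)
  also have "\<dots> \<le> norm u * norm v"
    by (intro mult_right_mono) (auto simp: c_def norm_sgn)
  finally show ?thesis .
qed

lemma cinner_finite: "cinner u (v :: 'd::finite ell2) = (\<Sum>i\<in>UNIV. coord u i * cnj (coord v i))"
  by (simp add: cinner.rep_eq)

lemma cinner_norm_sq: "cinner u u = complex_of_real ((norm u)\<^sup>2)"
  by (simp add: cinner_self norm_ell2_sq)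

text \<open>Equality in the Cauchy--Schwarz inequality, in the form that turns knowledge of a single
  coordinate of a vector of bounded length into knowledge of the vector.\<close>

lemma eq_of_cinner_eq:
  assumes "norm u \<le> norm v" "cinner u v = complex_of_real ((norm v)\<^sup>2)"
  shows "u = v"
proof -
  have i: "inner u v = (norm v)\<^sup>2" using assms(2) by (simp add: inner_ell2_def)
  have "(norm u)\<^sup>2 \<le> (norm v)\<^sup>2" using assms(1) by simp
  then have "(norm (u - v))\<^sup>2 \<le> 0"
    using i by (simp add: power2_norm_eq_inner inner_diff_left inner_diff_right inner_commute)
  then show ?thesis by simp
qed

text \<open>Only the closed ball is required as codomain, because points of arbitrary characters may lie
  on the sphere.\<close>

definition holomorphic_disc :: "(complex \<Rightarrow> 'd ell2) \<Rightarrow> bool" where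
  "holomorphic_disc f \<longleftrightarrow> (\<forall>i. (\<lambda>l. coord (f l) i) holomorphic_on ball 0 1) \<and>
     (\<forall>l. cmod l < 1 \<longrightarrow> norm (f l) \<le> 1)"

lemma holomorphic_disc_cinner:
  fixes f :: "complex \<Rightarrow> 'd::finite ell2"
  assumes "holomorphic_disc f"
  shows "(\<lambda>l. cinner (f l) v) holomorphic_on ball 0 1"
  using assms unfolding cinner_finite holomorphic_disc_def
  by (auto intro!: holomorphic_intros)

text \<open>The maximum principle applies to the coordinate of \<open>f\<close> in the direction of \<open>f 0\<close>, which
  attains its largest possible modulus at \<open>0\<close>; the other coordinates then vanish for lack of room in
  the ball.\<close>

lemma holomorphic_disc_const:
  fixes f :: "complex \<Rightarrow> 'd::finite ell2"
  assumes f: "holomorphic_disc f" and 0: "norm (f 0) = 1" and l: "cmod l < 1"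
  shows "f l = f 0"
proof -
  let ?u = "\<lambda>l. cinner (f l) (f 0)"
  have "?u constant_on ball 0 1"
  proof (rule maximum_modulus_principle[where U = "ball 0 1" and \<xi> = 0])
    show "?u holomorphic_on ball 0 1" by (rule holomorphic_disc_cinner[OF f])
    fix z :: complex assume "z \<in> ball 0 1"
    then show "cmod (?u z) \<le> cmod (?u 0)"
      using cmod_cinner_le[of "f z" "f 0"] f 0 by (auto simp: holomorphic_disc_def cinner_norm_sq)
  qed auto
  then have "?u l = ?u 0" using l by (auto simp: constant_on_def)
  then show ?thesis
    using f 0 l by (intro eq_of_cinner_eq) (auto simp: cinner_norm_sq holomorphic_disc_def)
qed

text \<open>The Schwarz lemma for scalar functions requires values in the open disc. A coordinate that
  reaches the unit circle would be constant by the maximum principle, but it vanishes at \<open>0\<close>.\<close>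

lemma holomorphic_disc_Schwarz_strict:
  fixes f :: "complex \<Rightarrow> 'd::finite ell2"
  assumes f: "holomorphic_disc f" and 0: "f 0 = 0" and v: "norm v \<le> 1" and l: "cmod l < 1"
  shows "cmod (cinner (f l) v) < 1"
proof (rule ccontr)
  let ?u = "\<lambda>l. cinner (f l) v"
  assume n: "\<not> cmod (?u l) < 1"
  have le: "cmod (?u z) \<le> 1" if "cmod z < 1" for z
  proof -
    have "norm (f z) * norm v \<le> 1 * 1"
      using f v that by (intro mult_mono) (auto simp: holomorphic_disc_def)
    then show ?thesis using cmod_cinner_le[of "f z" v] by simp
  qed
  have "?u constant_on ball 0 1"
  proof (rule maximum_modulus_principle[where U = "ball 0 1" and \<xi> = l])
    show "?u holomorphic_on ball 0 1" by (rule holomorphic_disc_cinner[OF f])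
    fix z :: complex assume "z \<in> ball 0 1"
    then show "cmod (?u z) \<le> cmod (?u l)" using le[of z] n by simp
  qed (use l in auto)
  then have "?u l = ?u 0" using l by (auto simp: constant_on_def)
  then show False using n 0 by simp
qed

lemma holomorphic_disc_Schwarz:
  fixes f :: "complex \<Rightarrow> 'd::finite ell2"
  assumes f: "holomorphic_disc f" and 0: "f 0 = 0" and l: "cmod l < 1"
  shows "norm (f l) \<le> cmod l"
proof (cases "f l = 0")
  case False
  define v where "v = f l /\<^sub>R norm (f l)"
  have v: "norm v = 1" using False by (simp add: v_def)
  have "cmod (cinner (f l) v) \<le> cmod l"
    by (rule Schwarz_Lemma[OF holomorphic_disc_cinner[OF f]])
      (use holomorphic_disc_Schwarz_strict[OF f 0, of v] 0 l v in auto)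
  moreover have "cinner (f l) v = norm (f l)"
    using False by (simp add: v_def scaleR_cscale cinner_cscale_right cinner_norm_sq power2_eq_square)
  ultimately show ?thesis by simp
qed simp

text \<open>The coordinate in the direction of \<open>v\<close> satisfies the Schwarz lemma with equality at \<open>s\<close>, so
  it is the identity; by the norm bound of the Schwarz lemma there is nothing in the orthogonal
  directions.\<close>

lemma holomorphic_disc_Schwarz_eq:
  fixes f :: "complex \<Rightarrow> 'd::finite ell2"
  assumes f: "holomorphic_disc f" and 0: "f 0 = 0" 
    and s: "cmod s < 1" "s \<noteq> 0" "f s = cscale s v" "norm v = 1" and l: "cmod l < 1"
  shows "f l = cscale l v"
proof -
  let ?u = "\<lambda>l. cinner (f l) v"
  have us: "?u s = s" using s by (simp add: cinner_scale_left cinner_norm_sq)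
  have "\<exists>\<alpha>. (\<forall>z. norm z < 1 \<longrightarrow> ?u z = \<alpha> * z) \<and> norm \<alpha> = 1"
    by (rule Schwarz_Lemma(3)[OF holomorphic_disc_cinner[OF f], of _ 0])
      (use holomorphic_disc_Schwarz_strict[OF f 0, of v] 0 s us in auto)
  then obtain \<alpha> where \<alpha>: "\<And>z. cmod z < 1 \<Longrightarrow> ?u z = \<alpha> * z" by blast
  have "\<alpha> = 1" using \<alpha>[OF s(1)] us s(2) by simp
  then have ul: "?u l = l" using \<alpha> l by simp
  show ?thesis
  proof (rule eq_of_cinner_eq)
    show "norm (f l) \<le> norm (cscale l v)"
      using holomorphic_disc_Schwarz[OF f 0 l] s by simp
    show "cinner (f l) (cscale l v) = complex_of_real ((norm (cscale l v))\<^sup>2)"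
      using ul s(4) by (simp add: cinner_cscale_right complex_norm_square[symmetric] mult.commute)
  qed
qed

text \<open>The automorphism of the unit disc that exchanges \<open>0\<close> and \<open>t\<close>.\<close>

definition disc_swap :: "real \<Rightarrow> complex \<Rightarrow> complex" where
  "disc_swap t l = (of_real t - l) / (1 - of_real t * l)"

lemma disc_swap_0 [simp]: "disc_swap t 0 = of_real t"
  and disc_swap_self [simp]: "disc_swap t (of_real t) = 0"
  by (simp_all add: disc_swap_def)

lemma disc_swap_denom: "\<lbrakk>\<bar>t\<bar> < 1; cmod l < 1\<rbrakk> \<Longrightarrow> 1 - of_real t * l \<noteq> 0"
proof
  assume "\<bar>t\<bar> < 1" "cmod l < 1" "1 - of_real t * l = 0"
  then have "cmod (of_real t * l) = 1" by (metis eq_iff_diff_eq_0 norm_one)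
  moreover have "\<bar>t\<bar> * cmod l < 1" 
    using mult_strict_mono[of "\<bar>t\<bar>" 1 "cmod l" 1] \<open>\<bar>t\<bar> < 1\<close> \<open>cmod l < 1\<close> by simp
  ultimately show False by (simp add: norm_mult)
qed

lemma disc_swap_in_disc:
  assumes "\<bar>t\<bar> < 1" "cmod l < 1" shows "cmod (disc_swap t l) < 1"
proof -
  have "(1 - t\<^sup>2) * (1 - (cmod l)\<^sup>2) > 0"
    using assms by (intro mult_pos_pos) (auto simp: abs_square_less_1 power_less_one_iff)
  moreover have "(cmod (1 - of_real t * l))\<^sup>2 - (cmod (of_real t - l))\<^sup>2 = (1 - t\<^sup>2) * (1 - (cmod l)\<^sup>2)"
    by (simp add: cmod_power2) algebra
  ultimately have "(cmod (of_real t - l))\<^sup>2 < (cmod (1 - of_real t * l))\<^sup>2" by linarith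
  then have "cmod (of_real t - l) < cmod (1 - of_real t * l)" by (rule power_less_imp_less_base) simp
  moreover have "0 < cmod (1 - of_real t * l)" using disc_swap_denom[OF assms] by simp
  ultimately show ?thesis by (simp add: disc_swap_def norm_divide)
qed

lemma disc_swap_swap:
  assumes "\<bar>t\<bar> < 1" "cmod l < 1" shows "disc_swap t (disc_swap t l) = l"
proof -
  define x where "x = complex_of_real t"
  have d: "1 - x * l \<noteq> 0" using disc_swap_denom[OF assms] by (simp add: x_def)
  have e: "1 - x * ((x - l) / (1 - x * l)) \<noteq> 0"
    using disc_swap_denom[OF assms(1) disc_swap_in_disc[OF assms]] by (simp add: x_def disc_swap_def)
  have "x - (x - l) / (1 - x * l) = l * (1 - x * ((x - l) / (1 - x * l)))"
    using d by (simp add: field_simps)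
  then show ?thesis unfolding disc_swap_def x_def[symmetric] using e
    by (metis nonzero_mult_div_cancel_right)
qed

lemma disc_swap_holomorphic: "\<bar>t\<bar> < 1 \<Longrightarrow> disc_swap t holomorphic_on ball 0 1"
  unfolding disc_swap_def[abs_def]
  by (intro holomorphic_intros) (use disc_swap_denom in auto)

text \<open>The circle of radius \<open>t\<close> meets its image under \<open>disc_swap t\<close>, since that image contains both
  \<open>0 = disc_swap t t\<close> and \<open>disc_swap t (- t) = 2 t / (1 + t\<^sup>2) > t\<close>. Explicitly, \<open>\<bar>disc_swap t (\<nu> t)\<bar> = t\<close> means
  \<open>\<bar>1 - \<nu>\<bar> = \<bar>1 - t\<^sup>2 \<nu>\<bar>\<close>, which for \<open>\<bar>\<nu>\<bar> = 1\<close> amounts to \<open>Re \<nu> = (1 + t\<^sup>2) / 2\<close>.\<close>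

lemma disc_swap_rotation:
  assumes "0 < t" "t < 1"
  obtains \<nu> where "cmod \<nu> = 1" "cmod (disc_swap t (\<nu> * of_real t)) = t"
proof -
  define x where "x = (1 + t\<^sup>2) / 2"
  have t2: "0 < t\<^sup>2" "t\<^sup>2 < 1" using assms by (auto simp: power_less_one_iff)
  have x: "0 < x" "x < 1" using t2 by (auto simp: x_def intro: add_pos_pos)
  then have "x\<^sup>2 < 1" by (simp add: power_less_one_iff)
  note x = x this
  define \<nu> where "\<nu> = Complex x (sqrt (1 - x\<^sup>2))"
  have r: "(Re \<nu>)\<^sup>2 + (Im \<nu>)\<^sup>2 = 1" using x by (simp add: \<nu>_def)
  then have 1: "cmod \<nu> = 1" by (simp add: cmod_def)
  have "(cmod (1 - \<nu>))\<^sup>2 = 1 - 2 * x + ((Re \<nu>)\<^sup>2 + (Im \<nu>)\<^sup>2)"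
    by (simp add: cmod_power2) (simp add: \<nu>_def power2_eq_square algebra_simps)
  moreover have "(cmod (1 - of_real (t\<^sup>2) * \<nu>))\<^sup>2 = 1 - 2 * x * t\<^sup>2 + (t\<^sup>2)\<^sup>2 * ((Re \<nu>)\<^sup>2 + (Im \<nu>)\<^sup>2)"
    by (simp add: cmod_power2) (simp add: \<nu>_def power2_eq_square power4_eq_xxxx algebra_simps)
  ultimately have "(cmod (1 - \<nu>))\<^sup>2 = (cmod (1 - of_real (t\<^sup>2) * \<nu>))\<^sup>2"
    unfolding r by (simp add: x_def power2_eq_square field_simps)
  then have eq: "cmod (1 - \<nu>) = cmod (1 - of_real (t\<^sup>2) * \<nu>)" by (simp add: power2_eq_iff_nonneg)
  have "1 - \<nu> \<noteq> 0" using x by (auto simp: \<nu>_def complex_eq_iff)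
  then have nz: "cmod (1 - of_real (t\<^sup>2) * \<nu>) \<noteq> 0" by (metis eq norm_eq_zero)
  have "disc_swap t (\<nu> * of_real t) = of_real t * ((1 - \<nu>) / (1 - of_real (t\<^sup>2) * \<nu>))"
    by (simp add: disc_swap_def power2_eq_square algebra_simps)
  then have "cmod (disc_swap t (\<nu> * of_real t)) = t"
    using eq nz assms by (simp add: norm_mult norm_divide)
  with 1 show ?thesis using that by blast
qed

lemma holomorphic_disc_swap:
  assumes "holomorphic_disc f" "\<bar>t\<bar> < 1"
  shows "holomorphic_disc (f \<circ> disc_swap t)"
proof -
  have "(\<lambda>l. coord (f l) i) \<circ> disc_swap t holomorphic_on ball 0 1" for i
    using assms disc_swap_in_disc[OF assms(2)]
    by (intro holomorphic_on_compose_gen[OF disc_swap_holomorphic, of _ _ "ball 0 1"])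
      (auto simp: holomorphic_disc_def)
  then show ?thesis 
    using assms disc_swap_in_disc[OF assms(2)] by (auto simp: holomorphic_disc_def o_def)
qed

text \<open>Precomposition with \<open>disc_swap s\<close> moves the zero from \<open>s\<close> to \<open>0\<close> and the value \<open>f 0\<close> to the
  parameter \<open>s\<close>, where the Schwarz lemma bounds it. The case of equality follows in the same way.\<close>

lemma holomorphic_disc_zero_le:
  fixes f :: "complex \<Rightarrow> 'd::finite ell2"
  assumes f: "holomorphic_disc f" and s: "0 < s" "s < 1" "f (of_real s) = 0"
  shows "norm (f 0) \<le> s"
proof -
  have "norm ((f \<circ> disc_swap s) (of_real s)) \<le> cmod (of_real s)"
    by (rule holomorphic_disc_Schwarz) (use holomorphic_disc_swap[OF f, of s] s in \<open>auto simp: o_def\<close>)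
  then show ?thesis using s by simp
qed

lemma holomorphic_disc_zero_eq:
  fixes f :: "complex \<Rightarrow> 'd::finite ell2"
  assumes f: "holomorphic_disc f" and s: "0 < s" "s < 1" "f (of_real s) = 0"
    and v: "f 0 = cscale (of_real s) v" "norm v = 1" and l: "cmod l < 1"
  shows "f l = cscale (disc_swap s l) v"
proof -
  have "(f \<circ> disc_swap s) (disc_swap s l) = cscale (disc_swap s l) v"
    by (rule holomorphic_disc_Schwarz_eq[where s = "of_real s"])
      (use holomorphic_disc_swap[OF f, of s] s v disc_swap_in_disc[of s l] l in \<open>auto simp: o_def\<close>)
  then show ?thesis using s l by (simp add: disc_swap_swap)
qed

section \<open>The bounded inverse theorem\<close>

lemma baire_ball_in_closure:
  fixes B :: "'b::banach set"
  assumes "closed B" "B \<noteq> {}" and cover: "B \<subseteq> (\<Union>n::nat. closure (D n))"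
  obtains n y r where "y \<in> B" "0 < r" "B \<inter> ball y r \<subseteq> closure (D n)"
proof -
  let ?X = "top_of_set B"
  let ?G = "range (\<lambda>n. B \<inter> closure (D n))"
  have "completely_metrizable_space ?X"
    using assms(1) by (intro completely_metrizable_space_closedin completely_metrizable_space_euclidean) simp
  moreover have "?X interior_of \<Union>?G \<noteq> {}"
  proof -
    have "\<Union>?G = topspace ?X" using cover by auto
    then show ?thesis using assms(2) by (simp only: interior_of_topspace) simp
  qed
  ultimately have "\<not> (\<forall>T\<in>?G. closedin ?X T \<and> ?X interior_of T = {})"
    using Baire_category_alt[of ?X ?G] by (meson countableI_type countable_image)
  then obtain T where T: "T \<in> ?G" "\<not> (closedin ?X T \<and> ?X interior_of T = {})"
    by blast
  then obtain n where n: "T = B \<inter> closure (D n)" by blast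
  have "closedin ?X T" unfolding n by (intro closedin_closed_Int) simp
  then obtain y where "y \<in> ?X interior_of T" using T(2) by blast
  then obtain U where U: "openin ?X U" "y \<in> U" "U \<subseteq> T" by (auto simp: interior_of_def)
  then obtain V where V: "open V" "U = B \<inter> V" by (auto simp: openin_open)
  then obtain r where "0 < r" "ball y r \<subseteq> V" using U(2) open_contains_ball by blast
  then show ?thesis using that[of y r n] U V n by blast
qed

text \<open>The usual proof, carried out for subspaces \<open>A\<close> and \<open>B\<close>: by Baire's theorem the closure of the
  image of some ball of \<open>A\<close> contains a ball of \<open>B\<close>, hence every \<open>z\<close> in \<open>B\<close> can be hit up to an error
  of half its norm by a vector of norm at most \<open>K\<close> times that of \<open>z\<close>. Iterating gives a preimage as a
  series dominated by a geometric one.\<close>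

lemma bounded_inverse:
  fixes f :: "'a::banach \<Rightarrow> 'b::banach"
  assumes A: "closed A" "subspace A" and B: "closed B" "subspace B"
    and bij: "bij_betw f A B"
    and add: "\<And>x y. x \<in> A \<Longrightarrow> y \<in> A \<Longrightarrow> f (x + y) = f x + f y"
    and scale: "\<And>r x. x \<in> A \<Longrightarrow> f (r *\<^sub>R x) = r *\<^sub>R f x"
    and bounded: "\<And>x. x \<in> A \<Longrightarrow> norm (f x) \<le> C * norm x"
  obtains K where "\<And>x. x \<in> A \<Longrightarrow> norm x \<le> K * norm (f x)"
proof -
  have fB: "f x \<in> B" if "x \<in> A" for x using bij that by (auto simp: bij_betw_def)
  have diff: "f (x - y) = f x - f y" if "x \<in> A" "y \<in> A" for x y
    using add[of x "(-1) *\<^sub>R y"] scale[of y "-1"] that subspace_scale[OF A(2), of y "-1"] by simp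
  let ?D = "\<lambda>n::nat. f ` {a \<in> A. norm a \<le> real n}"
  have cover: "B \<subseteq> (\<Union>n. closure (?D n))"
  proof
    fix y assume "y \<in> B"
    then obtain a where a: "a \<in> A" "y = f a" using bij by (auto simp: bij_betw_def)
    moreover obtain n where "norm a \<le> real n" using real_arch_simple by blast
    ultimately have "y \<in> ?D n" by blast
    then show "y \<in> (\<Union>n. closure (?D n))" using closure_subset[of "?D n"] by blast
  qed
  obtain n y r where y: "y \<in> B" "0 < r" "B \<inter> ball y r \<subseteq> closure (?D n)"
    by (rule baire_ball_in_closure[OF B(1) _ cover]) (use subspace_0[OF B(2)] in blast)+
  \<comment> \<open>Small \<open>z\<close> are differences of \<open>y + z\<close> and \<open>y\<close>, both in the closure of the image of the ball of
    radius \<open>n\<close>; this doubles the radius.\<close>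
  have half: "\<exists>a\<in>A. norm a \<le> 2 * real n \<and> norm (z - f a) < e" if z: "z \<in> B" "norm z < r" "0 < e" for z e
  proof -
    have "y + z \<in> closure (?D n)" "y \<in> closure (?D n)"
      using y z subspace_add[OF B(2)] by (auto simp: dist_norm)
    moreover have "0 < e / 2" using z(3) by simp
    ultimately obtain u v where uv: "u \<in> ?D n" "dist u (y + z) < e / 2" "v \<in> ?D n" "dist v y < e / 2"
      unfolding closure_approachable by blast
    then obtain a b where ab: "a \<in> A" "norm a \<le> n" "u = f a" "b \<in> A" "norm b \<le> n" "v = f b" by blast
    have "norm (a - b) \<le> 2 * real n" using ab norm_triangle_ineq4[of a b] by linarith
    moreover have "norm (z - f (a - b)) < e"
    proof -
      have eq: "z - f (a - b) = (y + z - u) - (y - v)" using ab diff[of a b] by simp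
      have "norm (z - f (a - b)) \<le> norm (y + z - u) + norm (y - v)"
        unfolding eq by (rule norm_triangle_ineq4)
      then show ?thesis using uv by (simp add: dist_norm norm_minus_commute)
    qed
    ultimately show ?thesis using subspace_diff[OF A(2) ab(1,4)] by blast
  qed
  \<comment> \<open>Scaling \<open>z\<close> to norm \<open>r / 2\<close> and allowing the error \<open>r / 4\<close> halves the norm; the preimage of
    norm at most \<open>2 n\<close> is scaled back by \<open>2 \<bar>z\<bar> / r\<close>.\<close>
  define K where "K = 4 * real n / r"
  have step: "\<exists>a\<in>A. norm a \<le> K * norm z \<and> norm (z - f a) \<le> norm z / 2" if z: "z \<in> B" for z
  proof (cases "z = 0")
    case True
    then show ?thesis using subspace_0[OF A(2)] scale[of 0 0] by (intro bexI[of _ 0]) auto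
  next
    case False
    define c where "c = r / (2 * norm z)"
    have c: "c > 0" using False y(2) by (simp add: c_def)
    have cz: "c * norm z = r / 2" using False by (simp add: c_def)
    obtain a where a: "a \<in> A" "norm a \<le> 2 * real n" "norm (c *\<^sub>R z - f a) < r / 4"
    proof -
      have "norm (c *\<^sub>R z) < r" using cz c y(2) by simp
      then show ?thesis
        using half[of "c *\<^sub>R z" "r / 4"] subspace_scale[OF B(2) z, of c] y(2) that by auto
    qed
    have "z - f ((1 / c) *\<^sub>R a) = (1 / c) *\<^sub>R (c *\<^sub>R z - f a)"
      using a(1) c by (simp add: scale scaleR_diff_right)
    then have "norm (z - f ((1 / c) *\<^sub>R a)) = norm (c *\<^sub>R z - f a) / c" using c by simp
    also have "\<dots> \<le> (r / 4) / c" using a(3) c by (intro divide_right_mono) auto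
    also have "\<dots> = norm z / 2" using y(2) False by (simp add: c_def)
    finally have 1: "norm (z - f ((1 / c) *\<^sub>R a)) \<le> norm z / 2" .
    have "norm ((1 / c) *\<^sub>R a) \<le> 2 * real n / c" using a(2) c by (simp add: divide_right_mono)
    also have "\<dots> = K * norm z" using y(2) False by (simp add: c_def K_def)
    finally show ?thesis using 1 subspace_scale[OF A(2) a(1)] by blast
  qed
  then obtain g where g: "\<And>z. z \<in> B \<Longrightarrow> g z \<in> A" "\<And>z. z \<in> B \<Longrightarrow> norm (g z) \<le> K * norm z"
    "\<And>z. z \<in> B \<Longrightarrow> norm (z - f (g z)) \<le> norm z / 2" by metis
  have K0: "0 \<le> K" using y(2) by (simp add: K_def)
  have "norm x \<le> (2 * K) * norm (f x)" if x: "x \<in> A" for x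
  proof -
    \<comment> \<open>The \<open>k\<close>-th remainder after subtracting the images of the first \<open>k\<close> approximate preimages.\<close>
    define z where "z k = ((\<lambda>z. z - f (g z)) ^^ k) (f x)" for k
    have z0: "z 0 = f x" and zS: "z (Suc k) = z k - f (g (z k))" for k by (auto simp: z_def)
    have zB: "z k \<in> B" for k
      by (induction k) (auto simp: z0 zS x fB g intro!: subspace_diff[OF B(2)])
    have zn: "norm (z k) \<le> norm (f x) * (1/2) ^ k" for k
    proof (induction k)
      case (Suc k)
      then show ?case using g(3)[OF zB, of k] by (simp add: zS)
    qed (simp add: z0)
    have gn: "norm (g (z k)) \<le> K * norm (f x) * (1/2) ^ k" for k
    proof -
      have "norm (g (z k)) \<le> K * norm (z k)" by (rule g(2)[OF zB])
      also have "\<dots> \<le> K * (norm (f x) * (1/2) ^ k)" by (intro mult_left_mono zn K0)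
      finally show ?thesis by (simp add: mult.assoc)
    qed
    have geo: "(\<lambda>k. K * norm (f x) * (1/2) ^ k) sums (K * norm (f x) * 2)"
      using sums_mult[OF geometric_sums[of "1/2::real"]] by simp
    have summ: "summable (\<lambda>k. norm (g (z k)))"
      by (rule summable_comparison_test'[OF sums_summable[OF geo], of 0]) (use gn in auto)
    define s where "s = suminf (\<lambda>k. g (z k))"
    have lim: "(\<lambda>m. \<Sum>k<m. g (z k)) \<longlonglongrightarrow> s"
      unfolding s_def by (rule summable_LIMSEQ[OF summable_norm_cancel[OF summ]])
    have part: "(\<Sum>k<m. g (z k)) \<in> A" for m by (intro subspace_sum A g zB)
    have sA: "s \<in> A" by (rule closed_sequentially[OF A(1) part lim])
    have fpart: "f (\<Sum>k<m. g (z k)) = f x - z m" for m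
    proof (induction m)
      case 0
      then show ?case using scale[of 0 0] subspace_0[OF A(2)] by (simp add: z0)
    next
      case (Suc m)
      then show ?case by (simp add: add part g zB zS)
    qed
    have "(\<lambda>m. f (\<Sum>k<m. g (z k))) \<longlonglongrightarrow> f s"
    proof (rule Lim_null_comparison[THEN LIM_zero_cancel])
      show "\<forall>\<^sub>F m in sequentially. norm (f (\<Sum>k<m. g (z k)) - f s) \<le> C * norm ((\<Sum>k<m. g (z k)) - s)"
        unfolding diff[OF part sA, symmetric]
        by (intro always_eventually allI bounded subspace_diff A part sA)
      show "(\<lambda>m. C * norm ((\<Sum>k<m. g (z k)) - s)) \<longlonglongrightarrow> 0"
        by (intro tendsto_mult_right_zero tendsto_norm_zero LIM_zero lim)
    qed
    moreover have "(\<lambda>m. f (\<Sum>k<m. g (z k))) \<longlonglongrightarrow> f x - 0"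
      unfolding fpart
    proof (intro tendsto_diff tendsto_const Lim_null_comparison[of z])
      show "\<forall>\<^sub>F k in sequentially. norm (z k) \<le> norm (f x) * (1/2) ^ k" using zn by simp
      show "(\<lambda>k. norm (f x) * (1/2) ^ k) \<longlonglongrightarrow> 0"
        by (intro tendsto_mult_right_zero LIMSEQ_power_zero) simp
    qed
    ultimately have "f s = f x" using LIMSEQ_unique by fastforce
    then have "s = x" using bij sA x by (auto simp: bij_betw_def inj_on_def)
    moreover have "norm s \<le> K * norm (f x) * 2"
      unfolding s_def using suminf_le[OF gn summ sums_summable[OF geo]] summable_norm[OF summ] sums_unique[OF geo] by linarith
    ultimately show ?thesis by (simp add: mult.commute mult.left_commute)
  qed
  then show ?thesis using that by blast
qed

section \<open>Inverses and compositions of isomorphisms\<close>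

lemma scaleR_cscale_op: "r *\<^sub>R a = cscale_op (of_real r) a"
  by (intro blinfun_eqI) (simp add: cscale_op.rep_eq scaleR_cscale blinfun.scaleR_left)

lemma tensor_algebra_scaleR: "a \<in> tensor_algebra I \<Longrightarrow> r *\<^sub>R a \<in> tensor_algebra I"
  by (simp add: scaleR_cscale_op tensor_algebra_ops)

lemma subspace_tensor_algebra: "subspace (tensor_algebra I)"
  by (simp add: subspace_def zero_in_tensor_algebra tensor_algebra_ops tensor_algebra_scaleR)

lemma algebraic_isomorphismD:
  assumes "algebraic_isomorphism I J \<phi>"
  shows "bij_betw \<phi> (tensor_algebra I) (tensor_algebra J)"
    and "a \<in> tensor_algebra I \<Longrightarrow> \<phi> a \<in> tensor_algebra J"
    and "a \<in> tensor_algebra I \<Longrightarrow> b \<in> tensor_algebra I \<Longrightarrow> \<phi> (a + b) = \<phi> a + \<phi> b"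
    and "a \<in> tensor_algebra I \<Longrightarrow> b \<in> tensor_algebra I \<Longrightarrow> \<phi> (a o\<^sub>L b) = \<phi> a o\<^sub>L \<phi> b"
    and "a \<in> tensor_algebra I \<Longrightarrow> \<phi> (cscale_op c a) = cscale_op c (\<phi> a)"
  using assms by (auto simp: algebraic_isomorphism_def dest: bij_betwE)

abbreviation isomorphism_inverse ::
    "'d ncpoly set \<Rightarrow> (('d list ell2 \<Rightarrow>\<^sub>L 'd list ell2) \<Rightarrow> ('e list ell2 \<Rightarrow>\<^sub>L 'e list ell2)) \<Rightarrow>
     (('e list ell2 \<Rightarrow>\<^sub>L 'e list ell2) \<Rightarrow> ('d list ell2 \<Rightarrow>\<^sub>L 'd list ell2))" where
  "isomorphism_inverse I \<equiv> inv_into (tensor_algebra I)"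

lemma isomorphism_inverse:
  assumes "algebraic_isomorphism I J \<phi>"
  shows "b \<in> tensor_algebra J \<Longrightarrow> isomorphism_inverse I \<phi> b \<in> tensor_algebra I"
    and "b \<in> tensor_algebra J \<Longrightarrow> \<phi> (isomorphism_inverse I \<phi> b) = b"
    and "a \<in> tensor_algebra I \<Longrightarrow> isomorphism_inverse I \<phi> (\<phi> a) = a"
  using algebraic_isomorphismD(1)[OF assms]
  by (auto simp: bij_betw_def inv_into_into f_inv_into_f)

lemma algebraic_isomorphism_inverse:
  assumes \<phi>: "algebraic_isomorphism I J \<phi>"
  shows "algebraic_isomorphism J I (isomorphism_inverse I \<phi>)"
proof -
  note i = isomorphism_inverse[OF \<phi>]
  have eqI: "isomorphism_inverse I \<phi> b = a" if "a \<in> tensor_algebra I" "\<phi> a = b" for a b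
    using i(3)[of a] that by simp
  show ?thesis
    unfolding algebraic_isomorphism_def
    using algebraic_isomorphismD(1)[OF \<phi>]
    by (auto intro!: bij_betw_inv_into eqI simp: i algebraic_isomorphismD[OF \<phi>] tensor_algebra_ops)
qed

lemma algebraic_isomorphism_comp:
  assumes \<phi>: "algebraic_isomorphism I J \<phi>" and \<psi>: "algebraic_isomorphism J K \<psi>"
  shows "algebraic_isomorphism I K (\<psi> \<circ> \<phi>)"
  unfolding algebraic_isomorphism_def
  using algebraic_isomorphismD[OF \<phi>] algebraic_isomorphismD[OF \<psi>]
  by (auto intro: bij_betw_trans)

lemma bounded_isomorphism_inverse:
  assumes \<phi>: "bounded_isomorphism I J \<phi>"
  shows "bounded_isomorphism J I (isomorphism_inverse I \<phi>)"
proof -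
  have alg: "algebraic_isomorphism I J \<phi>" using \<phi> by (simp add: bounded_isomorphism_def)
  note i = isomorphism_inverse[OF alg] and D = algebraic_isomorphismD[OF alg]
  obtain C where C: "\<And>a. a \<in> tensor_algebra I \<Longrightarrow> norm (\<phi> a) \<le> C * norm a"
    using \<phi> by (auto simp: bounded_isomorphism_def)
  obtain K where K: "\<And>a. a \<in> tensor_algebra I \<Longrightarrow> norm a \<le> K * norm (\<phi> a)"
  proof (rule bounded_inverse[OF tensor_algebra_closed subspace_tensor_algebra
        tensor_algebra_closed subspace_tensor_algebra D(1)])
    show "\<phi> (r *\<^sub>R a) = r *\<^sub>R \<phi> a" if "a \<in> tensor_algebra I" for r a
      unfolding scaleR_cscale_op by (rule D(5)[OF that])
  qed (use D(3) C in auto)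
  have "norm (isomorphism_inverse I \<phi> b) \<le> K * norm b" if "b \<in> tensor_algebra J" for b
    using K[OF i(1)[OF that]] by (simp add: i(2)[OF that])
  then show ?thesis
    using algebraic_isomorphism_inverse[OF alg] by (auto simp: bounded_isomorphism_def)
qed

lemma bounded_isomorphism_comp:
  assumes \<phi>: "bounded_isomorphism I J \<phi>" and \<psi>: "bounded_isomorphism J K \<psi>"
  shows "bounded_isomorphism I K (\<psi> \<circ> \<phi>)"
proof -
  obtain C where C: "\<And>a. a \<in> tensor_algebra I \<Longrightarrow> norm (\<phi> a) \<le> C * norm a"
    using \<phi> by (auto simp: bounded_isomorphism_def)
  obtain D where D: "\<And>a. a \<in> tensor_algebra J \<Longrightarrow> norm (\<psi> a) \<le> D * norm a"
    using \<psi> by (auto simp: bounded_isomorphism_def)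
  have "norm (\<psi> (\<phi> a)) \<le> (\<bar>D\<bar> * C) * norm a" if a: "a \<in> tensor_algebra I" for a
  proof -
    have "norm (\<psi> (\<phi> a)) \<le> D * norm (\<phi> a)"
      using \<phi> a by (intro D) (auto simp: bounded_isomorphism_def dest: algebraic_isomorphismD(2))
    also have "\<dots> \<le> \<bar>D\<bar> * norm (\<phi> a)" by (intro mult_right_mono) auto
    also have "\<dots> \<le> \<bar>D\<bar> * (C * norm a)" by (intro mult_left_mono C a) auto
    finally show ?thesis by (simp add: mult.assoc)
  qed
  moreover have "algebraic_isomorphism I K (\<psi> \<circ> \<phi>)"
    using \<phi> \<psi> by (auto simp: bounded_isomorphism_def intro: algebraic_isomorphism_comp)
  ultimately show ?thesis by (auto simp: bounded_isomorphism_def)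
qed

lemma isometric_isomorphism_inverse:
  assumes "isometric_isomorphism I J \<phi>"
  shows "isometric_isomorphism J I (isomorphism_inverse I \<phi>)"
proof -
  have alg: "algebraic_isomorphism I J \<phi>" using assms by (simp add: isometric_isomorphism_def)
  note i = isomorphism_inverse[OF alg]
  have "norm (isomorphism_inverse I \<phi> b) = norm b" if "b \<in> tensor_algebra J" for b
    using assms i(1)[OF that] i(2)[OF that] by (metis isometric_isomorphism_def)
  then show ?thesis
    using algebraic_isomorphism_inverse[OF alg] by (simp add: isometric_isomorphism_def)
qed

lemma isometric_isomorphism_comp:
  assumes "isometric_isomorphism I J \<phi>" "isometric_isomorphism J K \<psi>"
  shows "isometric_isomorphism I K (\<psi> \<circ> \<phi>)"
  using assms
  by (auto simp: isometric_isomorphism_def intro: algebraic_isomorphism_comp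
      dest: algebraic_isomorphismD(2))

lemma isometric_imp_bounded_isomorphism:
  "isometric_isomorphism I J \<phi> \<Longrightarrow> bounded_isomorphism I J \<phi>"
  by (auto simp: isometric_isomorphism_def bounded_isomorphism_def intro!: exI[of _ 1])

section \<open>Characters and their points\<close>

lemma character_comp:
  assumes \<rho>: "character J \<rho>" and \<phi>: "algebraic_isomorphism I J \<phi>"
  shows "character I (\<rho> \<circ> \<phi>)"
proof -
  note D = algebraic_isomorphismD[OF \<phi>]
  obtain b where b: "b \<in> tensor_algebra J" "\<rho> b \<noteq> 0" using \<rho> by (auto simp: character_def)
  then have "\<exists>a\<in>tensor_algebra I. (\<rho> \<circ> \<phi>) a \<noteq> 0"
    using isomorphism_inverse(1,2)[OF \<phi> b(1)] by (intro bexI[of _ "isomorphism_inverse I \<phi> b"]) auto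
  then show ?thesis using \<rho> D by (auto simp: character_def)
qed

lemma characterD:
  assumes "character I \<rho>" "a \<in> tensor_algebra I"
  shows "b \<in> tensor_algebra I \<Longrightarrow> \<rho> (a + b) = \<rho> a + \<rho> b"
    and "b \<in> tensor_algebra I \<Longrightarrow> \<rho> (a o\<^sub>L b) = \<rho> a * \<rho> b"
    and "\<rho> (cscale_op c a) = c * \<rho> a"
  using assms by (auto simp: character_def)

lemma character_0: "character I \<rho> \<Longrightarrow> \<rho> 0 = 0"
  using characterD(1)[of I \<rho> 0 0] by (simp add: zero_in_tensor_algebra)

lemma character_sum:
  assumes \<rho>: "character I \<rho>" and a: "\<And>x. x \<in> F \<Longrightarrow> a x \<in> tensor_algebra I"
  shows "\<rho> (\<Sum>x\<in>F. a x) = (\<Sum>x\<in>F. \<rho> (a x))"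
  using a
proof (induction F rule: infinite_finite_induct)
  case (insert x F)
  then have "(\<Sum>x\<in>F. a x) \<in> tensor_algebra I" by (intro subspace_sum subspace_tensor_algebra) auto
  then show ?case using insert characterD(1)[OF \<rho>, of "a x"] by simp
qed (simp_all add: character_0[OF \<rho>])

lemma character_continuous: 
  assumes "character I \<rho>" shows "continuous_on (tensor_algebra I) \<rho>"
  unfolding continuous_on_iff
proof (intro ballI allI impI)
  fix a :: "'a list ell2 \<Rightarrow>\<^sub>L 'a list ell2" and e :: real
  assume a: "a \<in> tensor_algebra I" and "0 < e"
  have "dist (\<rho> b) (\<rho> a) \<le> dist b a" if b: "b \<in> tensor_algebra I" for b
  proof -
    have d: "b - a \<in> tensor_algebra I" using a b by (intro subspace_diff subspace_tensor_algebra)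
    have "\<rho> b - \<rho> a = \<rho> (b - a)" using characterD(1)[OF assms d a] by simp
    then show ?thesis using character_norm_le[OF assms d] by (simp add: dist_norm)
  qed
  then show "\<exists>d>0. \<forall>b\<in>tensor_algebra I. dist b a < d \<longrightarrow> dist (\<rho> b) (\<rho> a) < e"
    using \<open>0 < e\<close> by (intro exI[of _ e]) (auto intro: le_less_trans)
qed

text \<open>Characters are contractive, hence continuous, so that agreement on the generators extends to
  the closed algebra generated by them.\<close>

lemma character_eqI:
  assumes \<rho>: "character I \<rho>" and \<sigma>: "character I \<sigma>"
    and eq: "\<And>i. \<rho> (shift I i) = \<sigma> (shift I i)" and a: "a \<in> tensor_algebra I"
  shows "\<rho> a = \<sigma> a"
  using a
proof (induction rule: tensor_algebra_induct)
  case closed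
  have "closedin (top_of_set (tensor_algebra I)) {a \<in> tensor_algebra I. \<rho> a - \<sigma> a = 0}"
    using assms by (intro continuous_closedin_preimage_constant continuous_on_diff character_continuous)
  then show ?case using tensor_algebra_closed[of I] by (auto dest: closedin_closed_trans)
next
  case id
  show ?case using \<rho> \<sigma> by (simp add: character_fock_id)
next
  case (shift i)
  show ?case by (rule eq)
qed (simp_all add: characterD[OF \<rho>] characterD[OF \<sigma>])

lemma vacuum_character:
  assumes "homogeneous_ideal I"
  shows "character I (vacuum_character I)" and "vacuum_character I (shift I i) = 0"
  using theI'[OF vacuum_character_ex1[OF assms]] unfolding vacuum_character_def[symmetric] by auto

text \<open>The space \<open>\<complex>\<^sup>d\<close> of points is \<open>'d ell2\<close> with \<open>'d\<close> finite, so that it comes with its Hilbert space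
  structure; every family is square summable here.\<close>

definition character_point ::
    "'d::finite ncpoly set \<Rightarrow> (('d list ell2 \<Rightarrow>\<^sub>L 'd list ell2) \<Rightarrow> complex) \<Rightarrow> 'd ell2" where
  "character_point I \<rho> = Abs_ell2 (\<lambda>i. \<rho> (shift I i))"

lemma coord_character_point [simp]: "coord (character_point I \<rho>) i = \<rho> (shift I i)"
  by (simp add: character_point_def Abs_ell2_inverse)

lemma norm_orth_proj_fock_le: "norm (orth_proj (fock I) x) \<le> norm x"
proof -
  let ?P = "orth_proj (fock I)"
  have 0: "inner (x - ?P x) (?P x) = 0"
    by (simp add: inner_ell2_def proj_fock(1,2))
  have "(norm x)\<^sup>2 = (norm ((x - ?P x) + ?P x))\<^sup>2" by simp
  also have "\<dots> = (norm (x - ?P x))\<^sup>2 + (norm (?P x))\<^sup>2"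
    using 0 by (simp only: power2_norm_eq_inner inner_add_left inner_add_right inner_commute)
  finally have "(norm (?P x))\<^sup>2 \<le> (norm x)\<^sup>2" by simp
  then show ?thesis by (rule power2_le_imp_le) simp
qed

text \<open>The shift is a row contraction: the vectors \<open>e\<^sub>i \<otimes> u\<close> are orthogonal for distinct \<open>i\<close>, so
  Pythagoras applies before projecting.\<close>

lemma norm_shift_combination:
  fixes z :: "'d::finite ell2"
  shows "norm (\<Sum>i\<in>UNIV. cscale_op (cnj (coord z i)) (shift I i)) \<le> norm z"
proof (rule norm_blinfun_bound)
  fix u
  let ?P = "orth_proj (fock I)"
  have P: "bounded_linear ?P" by (intro bounded_linear_orth_proj closed_fock csubspace_fock)
  let ?v = "?P u"
  let ?g = "\<lambda>i. cscale (cnj (coord z i)) (tensor_left i ?v)"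
  have "blinfun_apply (\<Sum>i\<in>UNIV. cscale_op (cnj (coord z i)) (shift I i)) u
      = (\<Sum>i\<in>UNIV. ?P (?g i))"
    by (simp add: blinfun.sum_left cscale_op.rep_eq shift_eq fock_id_apply
        bounded_linear_Blinfun_apply[OF bounded_linear_tensor_left]
        orth_proj_cscale[OF closed_fock csubspace_fock])
  also have "\<dots> = ?P (\<Sum>i\<in>UNIV. ?g i)"
    by (rule linear_sum[OF bounded_linear.linear[OF P], symmetric])
  finally have "norm (blinfun_apply (\<Sum>i\<in>UNIV. cscale_op (cnj (coord z i)) (shift I i)) u)
      \<le> norm (\<Sum>i\<in>UNIV. ?g i)" using norm_orth_proj_fock_le by simp
  moreover have "(norm (\<Sum>i\<in>UNIV. ?g i))\<^sup>2 = (norm z * norm ?v)\<^sup>2"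
  proof -
    have "cinner (?g i) (?g j) = 0" if "i \<noteq> j" for i j
      unfolding cinner.rep_eq using that
      by (intro infsum_0) (auto simp: cscale.rep_eq tensor_left.rep_eq split: list.splits)
    then have "(norm (\<Sum>i\<in>UNIV. ?g i))\<^sup>2 = (\<Sum>i\<in>UNIV. (norm (?g i))\<^sup>2)"
      by (intro norm_sum_Pythagorean) (auto simp: pairwise_def orthogonal_def inner_ell2_def)
    also have "\<dots> = (norm z * norm ?v)\<^sup>2"
      by (simp add: norm_tensor_left power_mult_distrib norm_ell2_sq[of z] sum_distrib_right)
    finally show ?thesis .
  qed
  then have "norm (\<Sum>i\<in>UNIV. ?g i) = norm z * norm ?v" by (simp add: power2_eq_iff_nonneg)
  moreover have "norm z * norm ?v \<le> norm z * norm u" by (intro mult_left_mono norm_orth_proj_fock_le) auto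
  ultimately show "norm (blinfun_apply (\<Sum>i\<in>UNIV. cscale_op (cnj (coord z i)) (shift I i)) u)
      \<le> norm z * norm u" by linarith
qed simp

text \<open>At \<open>S = \<Sum>\<^sub>i cnj (z\<^sub>i) T\<^sub>i\<close> the character with point \<open>z\<close> has the value \<open>\<bar>z\<bar>\<^sup>2\<close>, while
  \<open>\<bar>S\<bar> \<le> \<bar>z\<bar>\<close>; contractivity leaves \<open>\<bar>z\<bar> \<le> 1\<close>.\<close>

lemma norm_character_point_le:
  assumes \<rho>: "character I \<rho>"
  shows "norm (character_point I \<rho>) \<le> 1"
proof -
  let ?z = "character_point I \<rho>"
  let ?S = "\<Sum>i\<in>UNIV. cscale_op (cnj (coord ?z i)) (shift I i)"
  have "?S \<in> tensor_algebra I"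
    by (intro subspace_sum subspace_tensor_algebra tensor_algebra_ops shift_in_tensor_algebra)
  then have "cmod (\<rho> ?S) \<le> norm ?S" by (rule character_norm_le[OF \<rho>])
  moreover have "\<rho> ?S = complex_of_real ((norm ?z)\<^sup>2)"
    by (subst character_sum[OF \<rho>])
      (simp_all add: tensor_algebra_ops shift_in_tensor_algebra characterD[OF \<rho>] norm_ell2_sq
        complex_norm_square mult.commute del: of_real_power)
  ultimately have "norm ?z * norm ?z \<le> 1 * norm ?z"
    using norm_shift_combination[of ?z I] by (simp add: power2_eq_square norm_mult)
  then show ?thesis by (metis mult_le_cancel_right norm_ge_zero norm_zero zero_le_one not_less order_le_less)
qed

section \<open>Points of characters are zeros of the ideal\<close>

lemma two_sided_ideal_of_homogeneous_ideal:
  assumes "homogeneous_ideal I" shows "two_sided_ideal I"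
proof -
  obtain S where "I = two_sided_ideal hull S" using assms by (auto simp: homogeneous_ideal_def)
  moreover have "two_sided_ideal (two_sided_ideal hull S)"
    by (rule hull_in) (auto simp: two_sided_ideal_def)
  ultimately show ?thesis by simp
qed

lemma linear_proj_fock: "linear (orth_proj (fock I))"
  by (intro bounded_linear.linear bounded_linear_orth_proj closed_fock csubspace_fock)

lemma linear_tensor_left: "linear (tensor_left i)"
  by (rule bounded_linear.linear[OF bounded_linear_tensor_left])

lemma cinner_sum_left: "cinner (\<Sum>x\<in>F. g x) u = (\<Sum>x\<in>F. cinner (g x) u)"
  by (induction F rule: infinite_finite_induct) (simp_all add: cinner_add_left)

lemma coord_sum: "coord (\<Sum>x\<in>F. g x) w = (\<Sum>x\<in>F. coord (g x) w)"
  by (rule linear_sum[OF bounded_linear.linear[OF bounded_linear_coord]])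

lemma coord_poly_at_basis: "coord (poly_at_basis f) w = Poly_Mapping.lookup f w"
  using in_keys_iff[of w f] by (auto simp: poly_at_basis_def coord_sum cscale.rep_eq ket.rep_eq if_distrib sum.delta cong: if_cong)

lemma poly_at_basis_sum: "poly_at_basis (\<Sum>x\<in>F. g x) = (\<Sum>x\<in>F. poly_at_basis (g x))"
  by (rule ell2_eqI) (simp add: coord_poly_at_basis coord_sum lookup_sum)

lemma poly_at_basis_single: "poly_at_basis (Poly_Mapping.single w c) = cscale c (ket w)"
  by (rule ell2_eqI) (simp add: coord_poly_at_basis lookup_single when_def cscale.rep_eq ket.rep_eq)

lemma poly_sum_monomials:
  "f = (\<Sum>w\<in>Poly_Mapping.keys f. Poly_Mapping.single w (Poly_Mapping.lookup f w))"
  by (rule poly_mapping_eqI) (auto simp: lookup_sum lookup_single when_def sum.delta' in_keys_iff)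

lemma poly_at_basis_two_sided_mult:
  "poly_at_basis (Poly_Mapping.single u 1 * f * Poly_Mapping.single v 1)
     = (\<Sum>w\<in>Poly_Mapping.keys f. cscale (Poly_Mapping.lookup f w) (ket (u @ w @ v)))"
proof -
  have "Poly_Mapping.single u 1 * f * Poly_Mapping.single v 1
      = (\<Sum>w\<in>Poly_Mapping.keys f. Poly_Mapping.single (u @ w @ v) (Poly_Mapping.lookup f w))"
    by (subst poly_sum_monomials[of f])
      (simp add: sum_distrib_left sum_distrib_right mult_single plus_list_def)
  then show ?thesis by (simp add: poly_at_basis_sum poly_at_basis_single)
qed

lemma homogeneous_two_sided_mult:
  assumes "homogeneous_poly n f"
  shows "homogeneous_poly (length u + n + length v)
     (Poly_Mapping.single u 1 * f * Poly_Mapping.single v 1)"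
  unfolding homogeneous_poly_def
proof
  fix x assume "x \<in> Poly_Mapping.keys (Poly_Mapping.single u 1 * f * Poly_Mapping.single v 1)"
  then have "coord (poly_at_basis (Poly_Mapping.single u 1 * f * Poly_Mapping.single v 1)) x \<noteq> 0"
    by (simp add: coord_poly_at_basis in_keys_iff)
  then obtain w where "w \<in> Poly_Mapping.keys f" "x = u @ w @ v"
    unfolding poly_at_basis_two_sided_mult coord_sum cscale.rep_eq ket.rep_eq
    by (rule sum.not_neutral_contains_not_neutral) (auto split: if_splits)
  then show "length x = length u + n + length v" using assms by (simp add: homogeneous_poly_def)
qed

text \<open>Vectors of \<open>fock I\<close> are orthogonal to \<open>(x\<^sup>u f x\<^sup>v)(e)\<close>. With \<open>u\<close> this makes \<open>fock I\<close> invariant under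
  the adjoints of left creation, with \<open>v\<close> it makes \<open>f\<close> vanish at the shift.\<close>

lemma fock_two_sided:
  assumes I: "homogeneous_ideal I" and x: "x \<in> fock I" and f: "f \<in> I" "homogeneous_poly n f"
  shows "(\<Sum>w\<in>Poly_Mapping.keys f. cnj (Poly_Mapping.lookup f w) * coord x (u @ w @ v)) = 0"
proof -
  have "Poly_Mapping.single u 1 * f * Poly_Mapping.single v 1 \<in> I"
    using two_sided_ideal_of_homogeneous_ideal[OF I] f(1) unfolding two_sided_ideal_def by blast
  then have "cinner x (poly_at_basis (Poly_Mapping.single u 1 * f * Poly_Mapping.single v 1)) = 0"
    using x homogeneous_two_sided_mult[OF f(2)] unfolding fock_iff by blast
  then show ?thesis
    by (simp add: poly_at_basis_two_sided_mult cinner_sum_right cinner_cscale_right cinner_ket_right)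
qed

text \<open>The adjoint of \<open>word_left u\<close>; see \<open>cinner_word_left\<close>.\<close>

lift_definition strip_prefix :: "'d list \<Rightarrow> 'd list ell2 \<Rightarrow> 'd list ell2" is "\<lambda>u f v. f (u @ v)"
proof -
  fix u :: "'d list" and f :: "'d list \<Rightarrow> complex"
  assume f: "(\<lambda>x. (cmod (f x))\<^sup>2) summable_on UNIV"
  then have "(\<lambda>x. (cmod (f x))\<^sup>2) summable_on range ((@) u)"
    by (rule summable_on_subset_banach) simp
  then show "(\<lambda>v. (cmod (f (u @ v)))\<^sup>2) summable_on UNIV"
    by (subst (asm) summable_on_reindex) (auto simp: o_def inj_on_def)
qed

definition word_left :: "'d list \<Rightarrow> 'd list ell2 \<Rightarrow> 'd list ell2" where
  "word_left w u = foldr tensor_left w u"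

lemma cinner_tensor_left: "cinner (tensor_left i u) x = cinner u (strip_prefix [i] x)"
proof -
  have "cinner (tensor_left i u) x
      = (\<Sum>\<^sub>\<infinity>w\<in>range ((#) i). coord (tensor_left i u) w * cnj (coord x w))"
    unfolding cinner.rep_eq
    by (rule infsum_cong_neutral) (auto simp: tensor_left.rep_eq split: list.splits)
  also have "\<dots> = cinner u (strip_prefix [i] x)"
    by (subst infsum_reindex) (auto simp: o_def tensor_left.rep_eq cinner.rep_eq strip_prefix.rep_eq)
  finally show ?thesis .
qed

lemma cinner_word_left: "cinner (word_left w u) x = cinner u (strip_prefix w x)"
proof (induction w arbitrary: x)
  case Nil
  have "strip_prefix [] x = x" by (rule ell2_eqI) (simp add: strip_prefix.rep_eq)
  then show ?case by (simp add: word_left_def)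
next
  case (Cons i w)
  have "strip_prefix w (strip_prefix [i] x) = strip_prefix (i # w) x"
    by (rule ell2_eqI) (simp add: strip_prefix.rep_eq)
  then show ?case using Cons by (simp add: word_left_def cinner_tensor_left)
qed

lemma strip_prefix_fock:
  assumes "homogeneous_ideal I" "x \<in> fock I" shows "strip_prefix u x \<in> fock I"
  unfolding fock_iff cinner_poly_at_basis
  using fock_two_sided[OF assms, of _ _ u "[]"] by (auto simp: strip_prefix.rep_eq)

text \<open>The orthogonal complement of \<open>fock I\<close> is invariant under left creation, since \<open>fock I\<close> is
  invariant under the adjoint. Hence projecting once at the end of a product of shifts is enough, as
  in \<open>word_op_apply\<close>.\<close>

lemma proj_tensor_left_proj:
  assumes I: "homogeneous_ideal I"
  shows "orth_proj (fock I) (tensor_left i (orth_proj (fock I) u)) = orth_proj (fock I) (tensor_left i u)"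
proof -
  let ?P = "orth_proj (fock I)"
  have "?P (tensor_left i (u - ?P u)) = 0"
    by (rule orth_proj_eq_0[OF csubspace_fock])
      (simp add: cinner_tensor_left proj_fock(2) strip_prefix_fock[OF I])
  then show ?thesis by (simp add: linear_diff[OF linear_proj_fock] linear_diff[OF linear_tensor_left])
qed

definition word_op :: "'d ncpoly set \<Rightarrow> 'd list \<Rightarrow> 'd list ell2 \<Rightarrow>\<^sub>L 'd list ell2" where
  "word_op I w = foldr (\<lambda>i a. shift I i o\<^sub>L a) w (fock_id I)"

lemma word_op_in_tensor_algebra: "word_op I w \<in> tensor_algebra I"
  by (induction w) (auto simp: word_op_def tensor_algebra_ops shift_in_tensor_algebra)

lemma word_op_apply:
  assumes I: "homogeneous_ideal I"
  shows "blinfun_apply (word_op I w) u = orth_proj (fock I) (word_left w (orth_proj (fock I) u))"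
proof (induction w)
  case Nil
  then show ?case by (simp add: word_op_def word_left_def fock_id_apply proj_fock)
next
  case (Cons i w)
  then show ?case
    by (simp add: word_op_def word_left_def shift_eq fock_id_apply proj_fock
        bounded_linear_Blinfun_apply[OF bounded_linear_tensor_left] proj_tensor_left_proj[OF I])
qed

text \<open>The relation \<open>f(T\<^sub>1, \<dots>, T\<^sub>d) = 0\<close>. For \<open>x\<close> in \<open>fock I\<close> the adjoint of \<open>f\<close> evaluated at the
  left creation operators annihilates \<open>x\<close>: the coordinate of the result at \<open>v\<close> is the inner product of
  \<open>x\<close> with \<open>(f x\<^sup>v)(e)\<close>. So the range of \<open>f\<close> evaluated at these operators is orthogonal to
  \<open>fock I\<close>.\<close>

lemma poly_op_zero:
  assumes I: "homogeneous_ideal I" and f: "f \<in> I" "homogeneous_poly n f"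
  shows "(\<Sum>w\<in>Poly_Mapping.keys f. cscale_op (Poly_Mapping.lookup f w) (word_op I w)) = 0"
proof (rule blinfun_eqI)
  fix u
  let ?P = "orth_proj (fock I)" let ?K = "Poly_Mapping.keys f" let ?c = "Poly_Mapping.lookup f"
  let ?y = "\<Sum>w\<in>?K. cscale (?c w) (word_left w (?P u))"
  have "cinner ?y x = 0" if x: "x \<in> fock I" for x
  proof -
    have "cinner ?y x = (\<Sum>w\<in>?K. cinner (cscale (?c w) (word_left w (?P u))) x)"
      by (rule cinner_sum_left)
    also have "\<dots> = cinner (?P u) (\<Sum>w\<in>?K. cscale (cnj (?c w)) (strip_prefix w x))"
      by (simp add: cinner_sum_right cinner_scale_left cinner_cscale_right cinner_word_left)
    also have "(\<Sum>w\<in>?K. cscale (cnj (?c w)) (strip_prefix w x)) = 0"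
      using fock_two_sided[OF I x f, of "[]"]
      by (intro ell2_eqI) (simp add: coord_sum cscale.rep_eq strip_prefix.rep_eq zero_ell2.rep_eq)
    also have "cinner (?P u) 0 = 0" by (metis cinner_commute cinner_zero_left complex_cnj_zero)
    finally show ?thesis .
  qed
  then have "?P ?y = 0" by (rule orth_proj_eq_0[OF csubspace_fock])
  then show "blinfun_apply (\<Sum>w\<in>?K. cscale_op (?c w) (word_op I w)) u = blinfun_apply 0 u"
    by (simp add: blinfun.sum_left cscale_op.rep_eq word_op_apply[OF I] linear_sum[OF linear_proj_fock]
        orth_proj_cscale[OF closed_fock csubspace_fock])
qed

definition word_value :: "'d ell2 \<Rightarrow> 'd list \<Rightarrow> complex" where
  "word_value z w = (\<Prod>i\<leftarrow>w. coord z i)"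

text \<open>Only homogeneous members of \<open>I\<close> are tested. As these generate \<open>I\<close> when \<open>I\<close> is a homogeneous
  ideal, this is then the set of common zeros of all of \<open>I\<close>.\<close>

definition variety :: "'d ncpoly set \<Rightarrow> 'd ell2 set" where
  "variety I = {z. \<forall>n. \<forall>f\<in>I. homogeneous_poly n f \<longrightarrow>
     (\<Sum>w\<in>Poly_Mapping.keys f. Poly_Mapping.lookup f w * word_value z w) = 0}"

lemma word_value_cscale: "word_value (cscale c z) w = c ^ length w * word_value z w"
  by (induction w) (auto simp: word_value_def cscale.rep_eq)

text \<open>The zero set of homogeneous polynomials is a cone: this is what makes discs of characters
  available.\<close>

lemma variety_cscale:
  assumes "z \<in> variety I" shows "cscale c z \<in> variety I"
  unfolding variety_def
proof (intro CollectI allI ballI impI)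
  fix n f assume f: "f \<in> I" "homogeneous_poly n f"
  have "(\<Sum>w\<in>Poly_Mapping.keys f. Poly_Mapping.lookup f w * word_value (cscale c z) w)
      = c ^ n * (\<Sum>w\<in>Poly_Mapping.keys f. Poly_Mapping.lookup f w * word_value z w)"
    unfolding sum_distrib_left using f(2)
    by (intro sum.cong) (auto simp: homogeneous_poly_def word_value_cscale)
  also have "\<dots> = 0" using assms f by (auto simp: variety_def)
  finally show "(\<Sum>w\<in>Poly_Mapping.keys f. Poly_Mapping.lookup f w * word_value (cscale c z) w) = 0" .
qed

lemma character_point_in_variety:
  assumes I: "homogeneous_ideal I" and \<rho>: "character I \<rho>"
  shows "character_point I \<rho> \<in> variety I"
proof -
  have w: "\<rho> (word_op I w) = word_value (character_point I \<rho>) w" for w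
  proof (induction w)
    case (Cons i w)
    have "word_op I (i # w) = shift I i o\<^sub>L word_op I w" by (simp add: word_op_def)
    then show ?case
      using Cons by (simp add: characterD(2)[OF \<rho>] shift_in_tensor_algebra
          word_op_in_tensor_algebra word_value_def)
  qed (simp add: word_op_def word_value_def character_fock_id[OF \<rho>])
  have "(\<Sum>w\<in>Poly_Mapping.keys f. Poly_Mapping.lookup f w * word_value (character_point I \<rho>) w)
      = \<rho> (\<Sum>w\<in>Poly_Mapping.keys f. cscale_op (Poly_Mapping.lookup f w) (word_op I w))" for f
    by (simp add: character_sum[OF \<rho>] tensor_algebra_ops word_op_in_tensor_algebra
        characterD(3)[OF \<rho>] w)
  then show ?thesis
    by (simp add: variety_def poly_op_zero[OF I] character_0[OF \<rho>])
qed

section \<open>Evaluation at zeros in the open ball\<close>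

lemma words_Suc: "{w::'d list. length w = Suc n} = (\<lambda>(i, w). i # w) ` (UNIV \<times> {w. length w = n})"
  by (force simp: length_Suc_conv image_iff)

lemma finite_words: "finite {w :: 'd::finite list. length w = n}"
  using finite_lists_length_eq[of "UNIV :: 'd set" n] by simp

lemma sum_word_value_sq:
  fixes z :: "'d::finite ell2"
  shows "(\<Sum>w | length w = n. (cmod (word_value z w))\<^sup>2) = (norm z)\<^sup>2 ^ n"
proof (induction n)
  case 0
  then show ?case by (simp add: word_value_def)
next
  case (Suc n)
  have "(\<Sum>w | length w = Suc n. (cmod (word_value z w))\<^sup>2)
      = (\<Sum>(i, w)\<in>UNIV \<times> {w. length w = n}. (cmod (coord z i))\<^sup>2 * (cmod (word_value z w))\<^sup>2)"
    unfolding words_Suc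
    by (subst sum.reindex)
      (auto simp: inj_on_def o_def case_prod_unfold word_value_def norm_mult power_mult_distrib)
  also have "\<dots> = (\<Sum>i\<in>UNIV. (cmod (coord z i))\<^sup>2) * (\<Sum>w | length w = n. (cmod (word_value z w))\<^sup>2)"
    by (simp add: sum.cartesian_product[symmetric] sum_product)
  finally show ?case by (simp add: Suc norm_ell2_sq[of z])
qed

text \<open>For \<open>z\<close> in the open ball this is \<open>\<xi>\<^sub>z = \<Sum>\<^sub>w cnj (z\<^sup>w) e\<^sub>w\<close>, a geometric series of tensor powers of
  \<open>cnj z\<close>; the coordinates are square summable because the words of length \<open>n\<close> contribute
  \<open>\<bar>z\<bar>\<^sup>2\<^sup>n\<close>. If \<open>z\<close> is a zero of \<open>I\<close>, then it lies in
  \<open>fock I\<close> and is an eigenvector of the adjoints of the shift.\<close>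

definition geometric_vector :: "'d::finite ell2 \<Rightarrow> 'd list ell2" where
  "geometric_vector z = Abs_ell2 (\<lambda>w. cnj (word_value z w))"

lemma coord_geometric_vector:
  fixes z :: "'d::finite ell2"
  assumes "norm z < 1"
  shows "coord (geometric_vector z) w = cnj (word_value z w)"
proof -
  let ?q = "(norm z)\<^sup>2"
  have q: "?q < 1" using assms by (simp add: power_less_one_iff)
  have "(\<lambda>w. (cmod (cnj (word_value z w)))\<^sup>2) summable_on UNIV"
  proof (rule sum_le_imp_sq_summable[where C = "1 / (1 - ?q)"])
    fix F :: "'d list set" assume F: "finite F"
    define N where "N = Suc (\<Sum>w\<in>F. length w)"
    have "F \<subseteq> (\<Union>n<N. {w. length w = n})"
      using member_le_sum[of _ F length] F by (auto simp: N_def less_Suc_eq_le)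
    then have "(\<Sum>w\<in>F. (cmod (cnj (word_value z w)))\<^sup>2)
        \<le> (\<Sum>w\<in>(\<Union>n<N. {w. length w = n}). (cmod (cnj (word_value z w)))\<^sup>2)"
      by (intro sum_mono2) (auto simp: finite_words)
    also have "\<dots> = (\<Sum>n<N. \<Sum>w | length w = n. (cmod (word_value z w))\<^sup>2)"
      by (subst sum.UNION_disjoint) (auto simp: finite_words)
    also have "\<dots> = (\<Sum>n<N. ?q ^ n)" by (simp only: sum_word_value_sq)
    also have "\<dots> \<le> suminf (\<lambda>n. ?q ^ n)"
      by (rule sum_le_suminf) (use q in auto)
    also have "\<dots> = 1 / (1 - ?q)" using q by (intro suminf_geometric) simp
    finally show "(\<Sum>w\<in>F. (cmod (cnj (word_value z w)))\<^sup>2) \<le> 1 / (1 - ?q)" .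
  qed
  then show ?thesis by (simp add: geometric_vector_def Abs_ell2_inverse)
qed

lemma geometric_vector_in_fock:
  assumes "z \<in> variety I" "norm z < 1" shows "geometric_vector z \<in> fock I"
  unfolding fock_iff cinner_poly_at_basis
proof (intro allI ballI impI)
  fix n f assume "f \<in> I" "homogeneous_poly n f"
  then have "cnj (\<Sum>w\<in>Poly_Mapping.keys f. Poly_Mapping.lookup f w * word_value z w) = 0"
    using assms(1) by (simp add: variety_def)
  then show "(\<Sum>w\<in>Poly_Mapping.keys f. cnj (Poly_Mapping.lookup f w) * coord (geometric_vector z) w) = 0"
    by (simp add: coord_geometric_vector[OF assms(2)])
qed

lemma strip_prefix_geometric_vector:
  assumes "norm z < 1"
  shows "strip_prefix [i] (geometric_vector z) = cscale (cnj (coord z i)) (geometric_vector z)"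
  by (rule ell2_eqI)
    (simp add: strip_prefix.rep_eq cscale.rep_eq coord_geometric_vector[OF assms] word_value_def)

lemma cinner_proj_fock: "x \<in> fock I \<Longrightarrow> cinner (orth_proj (fock I) u) x = cinner u x"
  using proj_fock(2)[of x I u] by (simp add: cinner_diff_left)

definition evaluation :: "'d::finite ell2 \<Rightarrow> ('d list ell2 \<Rightarrow>\<^sub>L 'd list ell2) \<Rightarrow> complex" where
  "evaluation z a = cinner (blinfun_apply a (ket [])) (geometric_vector z)"

text \<open>Since \<open>\<xi>\<^sub>z\<close> is an eigenvector of the adjoints of the generators, it is one of the adjoint of every \<open>a\<close>:
  the identity passes to sums, products and limits. It makes \<open>evaluation z\<close> multiplicative.\<close>

lemma cinner_geometric_vector:
  assumes z: "z \<in> variety I" "norm z < 1" and a: "a \<in> tensor_algebra I"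
  shows "cinner (blinfun_apply a u) (geometric_vector z) = evaluation z a * cinner u (geometric_vector z)"
proof -
  let ?\<xi> = "geometric_vector z" let ?\<Omega> = "ket [] :: 'a list ell2"
  have \<xi>: "?\<xi> \<in> fock I" by (rule geometric_vector_in_fock[OF z])
  have \<Omega>: "cinner ?\<Omega> ?\<xi> = 1"
    by (subst cinner_commute) (simp add: cinner_ket_right coord_geometric_vector[OF z(2)] word_value_def)
  have shift_act: "cinner (blinfun_apply (shift I i) u) ?\<xi> = coord z i * cinner u ?\<xi>" for i u
    by (simp add: shift_eq fock_id_apply cinner_proj_fock[OF \<xi>] cinner_tensor_left
        bounded_linear_Blinfun_apply[OF bounded_linear_tensor_left]
        strip_prefix_geometric_vector[OF z(2)] cinner_cscale_right)
  have "\<forall>u. cinner (blinfun_apply a u) ?\<xi> = cinner (blinfun_apply a ?\<Omega>) ?\<xi> * cinner u ?\<xi>"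
    using a
  proof (induction rule: tensor_algebra_induct)
    case closed
    have "{a \<in> tensor_algebra I. \<forall>u. cinner (blinfun_apply a u) ?\<xi> = cinner (blinfun_apply a ?\<Omega>) ?\<xi> * cinner u ?\<xi>}
        = tensor_algebra I \<inter> (\<Inter>u. {a. cinner (blinfun_apply a u) ?\<xi> = cinner (blinfun_apply a ?\<Omega>) ?\<xi> * cinner u ?\<xi>})"
      by blast
    moreover have "continuous_on UNIV (\<lambda>a. cinner (blinfun_apply a u) ?\<xi>)" for u :: "'a list ell2"
      unfolding continuous_on_def
      by (auto intro!: tendsto_cinner_left tendsto_intros)
    ultimately show ?case
      by (auto intro!: closed_Int tensor_algebra_closed closed_INT closed_Collect_eq
          continuous_on_mult continuous_on_const)
  next
    case id
    show ?case by (simp add: fock_id_apply cinner_proj_fock[OF \<xi>] \<Omega>)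
  next
    case (shift i)
    show ?case by (simp add: shift_act \<Omega>)
  next
    case (add a b)
    show ?case
    proof
      fix u
      show "cinner (blinfun_apply (a + b) u) ?\<xi> = cinner (blinfun_apply (a + b) ?\<Omega>) ?\<xi> * cinner u ?\<xi>"
        using add.IH[rule_format, of u] by (simp add: blinfun.add_left cinner_add_left distrib_right)
    qed
  next
    case (mult a b)
    have "cinner (blinfun_apply a v) ?\<xi> = cinner (blinfun_apply a ?\<Omega>) ?\<xi> * cinner v ?\<xi>"
      "cinner (blinfun_apply b v) ?\<xi> = cinner (blinfun_apply b ?\<Omega>) ?\<xi> * cinner v ?\<xi>" for v
      using mult.IH by blast+
    note ab = this
    show ?case
    proof
      fix u
      show "cinner (blinfun_apply (a o\<^sub>L b) u) ?\<xi> = cinner (blinfun_apply (a o\<^sub>L b) ?\<Omega>) ?\<xi> * cinner u ?\<xi>"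
        using ab(1)[of "blinfun_apply b u"] ab(2)[of u] ab(1)[of "blinfun_apply b ?\<Omega>"] by simp
    qed
  next
    case (scale c a)
    show ?case
    proof
      fix u
      show "cinner (blinfun_apply (cscale_op c a) u) ?\<xi> = cinner (blinfun_apply (cscale_op c a) ?\<Omega>) ?\<xi> * cinner u ?\<xi>"
        using scale.IH[rule_format, of u] by (simp add: cscale_op.rep_eq cinner_scale_left)
    qed
  qed
  then show ?thesis unfolding evaluation_def by blast
qed

lemma character_evaluation:
  assumes I: "homogeneous_ideal I" and z: "z \<in> variety I" "norm z < 1"
  shows "character I (evaluation z)"
    and "character_point I (evaluation z) = z"
proof -
  note \<xi> = geometric_vector_in_fock[OF z]
  have \<Omega>: "cinner (ket []) (geometric_vector z) = 1"
    by (subst cinner_commute) (simp add: cinner_ket_right coord_geometric_vector[OF z(2)] word_value_def)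
  show "character I (evaluation z)"
    unfolding character_def
  proof (intro conjI bexI[of _ "fock_id I"] ballI allI)
    show "evaluation z (fock_id I) \<noteq> 0"
      by (simp add: evaluation_def fock_id_apply cinner_proj_fock[OF \<xi>] \<Omega>)
  next
    fix a b assume "a \<in> tensor_algebra I" "b \<in> tensor_algebra I"
    then show "evaluation z (a + b) = evaluation z a + evaluation z b"
      "evaluation z (a o\<^sub>L b) = evaluation z a * evaluation z b"
      using cinner_geometric_vector[OF z, of a "blinfun_apply b (ket [])"]
      by (simp_all add: evaluation_def blinfun.add_left cinner_add_left)
  qed (simp_all add: tensor_algebra_ops evaluation_def cscale_op.rep_eq cinner_scale_left)
  show "character_point I (evaluation z) = z"
    by (rule ell2_eqI)
      (simp add: evaluation_def shift_eq fock_id_apply cinner_proj_fock[OF \<xi>] cinner_tensor_left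
        bounded_linear_Blinfun_apply[OF bounded_linear_tensor_left]
        strip_prefix_geometric_vector[OF z(2)] cinner_cscale_right \<Omega>)
qed

text \<open>Splitting \<open>a \<Omega>\<close> into its homogeneous components gives the Taylor expansion: the component of
  degree \<open>n\<close> contributes \<open>l\<^sup>n\<close> times its value at \<open>z\<close>.\<close>

lemma evaluation_holomorphic:
  fixes z :: "'d::finite ell2"
  assumes z: "norm z \<le> 1"
  shows "(\<lambda>l. evaluation (cscale l z) a) holomorphic_on ball 0 1"
proof -
  let ?v = "blinfun_apply a (ket [])"
  define c where "c n = (\<Sum>w | length w = n. coord ?v w * word_value z w)" for n
  show ?thesis
  proof (rule power_series_holomorphic)
    fix l :: complex assume "l \<in> ball 0 1"
    then have "cmod l * norm z < 1"
      using mult_le_one[of "norm z" "cmod l"] z mult_left_le[of "norm z" "cmod l"] by auto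
    then have l: "norm (cscale l z) < 1" by simp
    have "cinner (component n ?v) (geometric_vector (cscale l z)) = c n * (l - 0) ^ n" for n
    proof -
      have "cinner (component n ?v) (geometric_vector (cscale l z))
          = (\<Sum>\<^sub>\<infinity>w\<in>{w. length w = n}. coord ?v w * (l ^ length w * word_value z w))"
        unfolding cinner.rep_eq component.rep_eq
        by (rule infsum_cong_neutral) (auto simp: coord_geometric_vector[OF l] word_value_cscale)
      also have "\<dots> = c n * l ^ n"
        by (simp add: infsum_finite finite_words c_def sum_distrib_left mult_ac)
      finally show ?thesis by simp
    qed
    moreover have "(\<lambda>n. cinner (component n ?v) (geometric_vector (cscale l z))) sums
        cinner ?v (geometric_vector (cscale l z))"
      using component_sums[of ?v] unfolding sums_def cinner_sum_left[symmetric]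
      by (rule tendsto_cinner_left)
    ultimately show "(\<lambda>n. c n * (l - 0) ^ n) sums evaluation (cscale l z) a"
      by (simp add: evaluation_def)
  qed
qed

section \<open>Gauge automorphisms\<close>

text \<open>The unitary operators that act on the tensors of degree \<open>n\<close> as multiplication by the \<open>n\<close>-th power
  of \<open>cis t\<close>. The parameter is the angle, so that inverses correspond to negation and every parameter gives
  a unitary operator.\<close>

lift_definition degree_rotation :: "real \<Rightarrow> 'd list ell2 \<Rightarrow> 'd list ell2" is
  "\<lambda>t f w. cis (t * real (length w)) * f w"
  by (simp add: norm_mult)

lemma degree_rotation_linear:
  "degree_rotation t (u + v) = degree_rotation t u + degree_rotation t v"
  "degree_rotation t (u - v) = degree_rotation t u - degree_rotation t v"
  "degree_rotation t (cscale c u) = cscale c (degree_rotation t u)"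
  by (transfer; simp add: algebra_simps)+

lemma norm_degree_rotation [simp]: "norm (degree_rotation t u) = norm u"
proof -
  have "(norm (degree_rotation t u))\<^sup>2 = (norm u)\<^sup>2"
    by (simp add: norm_ell2_sq degree_rotation.rep_eq norm_mult)
  then show ?thesis by (simp add: power2_eq_iff_nonneg)
qed

lemma bounded_linear_degree_rotation: "bounded_linear (degree_rotation t)"
  by (rule bounded_linear_intro[where K = 1])
    (simp_all add: degree_rotation_linear scaleR_cscale)

lemma degree_rotation_inverse [simp]:
  "degree_rotation t (degree_rotation (- t) u) = u" "degree_rotation (- t) (degree_rotation t u) = u"
  by (rule ell2_eqI, simp add: degree_rotation.rep_eq mult.assoc[symmetric] cis_mult)+

lemma cinner_degree_rotation: "cinner (degree_rotation t u) v = cinner u (degree_rotation (- t) v)"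
  unfolding cinner.rep_eq degree_rotation.rep_eq
  by (intro infsum_cong) (simp add: cis_cnj)

lemma degree_rotation_tensor_left:
  "degree_rotation t (tensor_left i u) = cscale (cis t) (tensor_left i (degree_rotation t u))"
  by (rule ell2_eqI)
    (auto simp: degree_rotation.rep_eq tensor_left.rep_eq cscale.rep_eq distrib_left
      cis_mult[symmetric] split: list.splits)

lemma degree_rotation_fock:
  assumes u: "u \<in> fock I" shows "degree_rotation t u \<in> fock I"
  unfolding fock_iff
proof (intro allI ballI impI)
  fix n f assume f: "f \<in> I" "homogeneous_poly n f"
  have "cinner (degree_rotation t u) (poly_at_basis f) = cis (t * n) * cinner u (poly_at_basis f)"
    unfolding cinner_poly_at_basis sum_distrib_left using f(2)
    by (intro sum.cong) (auto simp: degree_rotation.rep_eq homogeneous_poly_def)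
  also have "\<dots> = 0" using u f unfolding fock_iff by simp
  finally show "cinner (degree_rotation t u) (poly_at_basis f) = 0" .
qed

lemma proj_degree_rotation:
  "orth_proj (fock I) (degree_rotation t u) = degree_rotation t (orth_proj (fock I) u)"
proof (rule orth_proj_unique[OF csubspace_fock])
  show "degree_rotation t (orth_proj (fock I) u) \<in> fock I"
    by (intro degree_rotation_fock proj_fock)
  show "\<forall>z\<in>fock I. cinner (degree_rotation t u - degree_rotation t (orth_proj (fock I) u)) z = 0"
    by (simp add: degree_rotation_linear(2)[symmetric] cinner_degree_rotation proj_fock degree_rotation_fock)
qed

definition gauge_automorphism ::
    "real \<Rightarrow> ('d list ell2 \<Rightarrow>\<^sub>L 'd list ell2) \<Rightarrow> ('d list ell2 \<Rightarrow>\<^sub>L 'd list ell2)" where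
  "gauge_automorphism t a = Blinfun (degree_rotation t) o\<^sub>L a o\<^sub>L Blinfun (degree_rotation (- t))"

lemma gauge_apply:
  "blinfun_apply (gauge_automorphism t a) u = degree_rotation t (blinfun_apply a (degree_rotation (- t) u))"
  by (simp add: gauge_automorphism_def bounded_linear_Blinfun_apply[OF bounded_linear_degree_rotation])

lemma gauge_inverse [simp]: "gauge_automorphism t (gauge_automorphism (- t) a) = a" "gauge_automorphism (- t) (gauge_automorphism t a) = a"
  using degree_rotation_inverse[of "- t"] by (intro blinfun_eqI, simp add: gauge_apply)+

lemma gauge_0 [simp]: "gauge_automorphism 0 a = a"
proof -
  have "degree_rotation 0 u = u" for u :: "'a list ell2"
    by (rule ell2_eqI) (simp add: degree_rotation.rep_eq)
  then show ?thesis by (intro blinfun_eqI) (simp add: gauge_apply)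
qed

lemma gauge_add: "gauge_automorphism t (a + b) = gauge_automorphism t a + gauge_automorphism t b"
  by (rule blinfun_eqI) (simp add: gauge_apply blinfun.add_left degree_rotation_linear)

lemma gauge_mult: "gauge_automorphism t (a o\<^sub>L b) = gauge_automorphism t a o\<^sub>L gauge_automorphism t b"
  by (rule blinfun_eqI) (simp add: gauge_apply)

lemma gauge_cscale: "gauge_automorphism t (cscale_op c a) = cscale_op c (gauge_automorphism t a)"
  by (rule blinfun_eqI) (simp add: gauge_apply cscale_op.rep_eq degree_rotation_linear)

lemma gauge_fock_id: "gauge_automorphism t (fock_id I) = fock_id I"
  by (rule blinfun_eqI) (simp add: gauge_apply fock_id_apply proj_degree_rotation)

lemma gauge_shift: "gauge_automorphism t (shift I i) = cscale_op (cis t) (shift I i)"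
  by (rule blinfun_eqI)
    (simp add: gauge_apply shift_eq fock_id_apply proj_degree_rotation[symmetric] cscale_op.rep_eq
      degree_rotation_tensor_left orth_proj_cscale[OF closed_fock csubspace_fock]
      bounded_linear_Blinfun_apply[OF bounded_linear_tensor_left])

lemma norm_gauge: "norm (gauge_automorphism t a) = norm a"
proof -
  have le: "norm (gauge_automorphism t a) \<le> norm a" for t and a :: "'a list ell2 \<Rightarrow>\<^sub>L 'a list ell2"
  proof (rule norm_blinfun_bound)
    show "norm (blinfun_apply (gauge_automorphism t a) u) \<le> norm a * norm u" for u
      using norm_blinfun[of a "degree_rotation (- t) u"] by (simp add: gauge_apply)
  qed simp
  show ?thesis using le[of t a] le[of "- t" "gauge_automorphism t a"] by simp
qed

lemma gauge_in_tensor_algebra: "a \<in> tensor_algebra I \<Longrightarrow> gauge_automorphism t a \<in> tensor_algebra I"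
proof (induction rule: tensor_algebra_induct)
  case closed
  have "bounded_linear (gauge_automorphism t)"
    by (rule bounded_linear_intro[where K = 1])
      (simp_all add: gauge_add scaleR_cscale_op gauge_cscale norm_gauge)
  then have "closed (gauge_automorphism t -` tensor_algebra I)"
    by (intro closed_vimage tensor_algebra_closed linear_continuous_on)
  moreover have "{a \<in> tensor_algebra I. gauge_automorphism t a \<in> tensor_algebra I}
      = tensor_algebra I \<inter> gauge_automorphism t -` tensor_algebra I" by blast
  ultimately show ?case by (simp add: closed_Int tensor_algebra_closed)
qed (simp_all add: gauge_fock_id gauge_shift gauge_add gauge_mult gauge_cscale
    tensor_algebra_ops shift_in_tensor_algebra)

lemma isometric_isomorphism_gauge: "isometric_isomorphism I I (gauge_automorphism t)"
proof -
  have "bij_betw (gauge_automorphism t) (tensor_algebra I) (tensor_algebra I)"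
    by (rule bij_betw_byWitness[where f' = "gauge_automorphism (- t)"]) (auto simp: gauge_in_tensor_algebra)
  then show ?thesis
    by (simp add: isometric_isomorphism_def algebraic_isomorphism_def gauge_add gauge_mult
        gauge_cscale norm_gauge)
qed

lemma algebraic_isomorphism_gauge: "algebraic_isomorphism I I (gauge_automorphism t)"
  using isometric_isomorphism_gauge[of I t] by (simp add: isometric_isomorphism_def)

lemma bounded_isomorphism_gauge: "bounded_isomorphism I I (gauge_automorphism t)"
  by (rule isometric_imp_bounded_isomorphism[OF isometric_isomorphism_gauge])

lemma character_point_gauge:
  assumes "character I \<rho>"
  shows "character_point I (\<rho> \<circ> gauge_automorphism t) = cscale (cis t) (character_point I \<rho>)"
  by (rule ell2_eqI)
    (simp add: gauge_shift cscale.rep_eq characterD(3)[OF assms] shift_in_tensor_algebra)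

section \<open>Moving the vacuum back by rotations\<close>

lemma character_eq_of_point:
  assumes "character I \<rho>" "character I \<sigma>" "character_point I \<rho> = character_point I \<sigma>"
    and a: "a \<in> tensor_algebra I"
  shows "\<rho> a = \<sigma> a"
proof (rule character_eqI[OF assms(1,2) _ a])
  show "\<rho> (shift I i) = \<sigma> (shift I i)" for i
    using arg_cong[OF assms(3), of "\<lambda>z. coord z i"] by simp
qed

lemma character_point_vacuum:
  assumes "homogeneous_ideal I" shows "character_point I (vacuum_character I) = 0"
  by (rule ell2_eqI) (simp add: vacuum_character(2)[OF assms] zero_ell2.rep_eq)

lemma character_point_cong:
  assumes "\<And>a. a \<in> tensor_algebra I \<Longrightarrow> \<rho> a = \<sigma> a"
  shows "character_point I \<rho> = character_point I \<sigma>"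
  by (rule ell2_eqI) (simp add: assms shift_in_tensor_algebra)

lemma cscale_0 [simp]: "cscale 0 u = 0"
  by (rule ell2_eqI) (simp add: cscale.rep_eq zero_ell2.rep_eq)

text \<open>The coordinates are the values of the evaluations at the fixed elements \<open>\<phi> T\<^sub>i\<close>, so this follows
  without any continuity of \<open>\<phi>\<close>; points of characters lie in the ball because characters are
  automatically contractive.\<close>

lemma holomorphic_disc_of_characters:
  fixes I :: "'d::finite ncpoly set" and J :: "'e::finite ncpoly set"
  assumes J: "homogeneous_ideal J" and \<phi>: "algebraic_isomorphism I J \<phi>"
    and w: "w \<in> variety J" "norm w = 1"
  shows "holomorphic_disc (\<lambda>l. character_point I (evaluation (cscale l w) \<circ> \<phi>))"
  unfolding holomorphic_disc_def
proof (intro conjI allI impI)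
  show "(\<lambda>l. coord (character_point I (evaluation (cscale l w) \<circ> \<phi>)) i) holomorphic_on ball 0 1" for i
    using evaluation_holomorphic[of w "\<phi> (shift I i)"] w(2) by simp
  fix l :: complex assume "cmod l < 1"
  then show "norm (character_point I (evaluation (cscale l w) \<circ> \<phi>)) \<le> 1"
    using w by (intro norm_character_point_le character_comp[OF _ \<phi>] character_evaluation[OF J])
      (auto intro: variety_cscale)
qed

lemma evaluation_eq_vacuum_character:
  assumes J: "homogeneous_ideal J" and w: "w \<in> variety J" and x: "x \<in> tensor_algebra J"
  shows "evaluation (cscale 0 w) x = vacuum_character J x"
  using character_evaluation[OF J variety_cscale[OF w, of 0]] vacuum_character(1)[OF J]
    character_point_vacuum[OF J] x
  by (intro character_eq_of_point[of J]) auto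

text \<open>If the point of \<open>\<rho>\<^sub>0 \<circ> \<phi>\<close> were on the sphere, the pulled back disc of characters through \<open>w\<close> would be
  constant by the maximum principle. As \<open>\<phi>\<close> is bijective, the evaluations at \<open>w / 2\<close> and \<open>0\<close> would
  then agree.\<close>

lemma character_point_vacuum_less_1:
  fixes I :: "'d::finite ncpoly set" and J :: "'e::finite ncpoly set"
  assumes J: "homogeneous_ideal J" and \<phi>: "algebraic_isomorphism I J \<phi>"
    and w: "w \<in> variety J" "norm w = 1"
  shows "norm (character_point I (vacuum_character J \<circ> \<phi>)) < 1"
proof (rule ccontr)
  let ?F = "\<lambda>l. character_point I (evaluation (cscale l w) \<circ> \<phi>)"
  note D = algebraic_isomorphismD[OF \<phi>]
  have ch: "character I (evaluation (cscale l w) \<circ> \<phi>)"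
    and ch': "character J (evaluation (cscale l w))" "character_point J (evaluation (cscale l w)) = cscale l w"
    if "cmod l < 1" for l
    using w that by (auto intro!: character_comp[OF _ \<phi>] character_evaluation[OF J] variety_cscale)
  have F0: "?F 0 = character_point I (vacuum_character J \<circ> \<phi>)"
    using evaluation_eq_vacuum_character[OF J w(1)] D(2) by (intro character_point_cong) auto
  assume "\<not> norm (character_point I (vacuum_character J \<circ> \<phi>)) < 1"
  moreover have "norm (character_point I (vacuum_character J \<circ> \<phi>)) \<le> 1"
    by (intro norm_character_point_le character_comp[OF _ \<phi>] vacuum_character J)
  ultimately have "norm (?F 0) = 1" using F0 by simp
  then have "?F (1 / 2) = ?F 0"
    by (intro holomorphic_disc_const[OF holomorphic_disc_of_characters[OF J \<phi> w]]) auto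
  then have eq: "evaluation (cscale (1/2) w) (\<phi> a) = evaluation (cscale 0 w) (\<phi> a)"
    if "a \<in> tensor_algebra I" for a
    using character_eq_of_point[OF ch[of "1/2"] ch[of 0] _ that] by (simp add: o_def)
  have "evaluation (cscale (1/2) w) b = evaluation (cscale 0 w) b" if "b \<in> tensor_algebra J" for b
    using eq[OF isomorphism_inverse(1)[OF \<phi> that]] by (simp add: isomorphism_inverse(2)[OF \<phi> that])
  then have "cscale (1/2) w = cscale 0 w"
    using ch'(2)[of "1/2"] ch'(2)[of 0] character_point_cong[of J "evaluation (cscale (1/2) w)"]
    by auto
  then have "norm (cscale (1/2) w) = norm (cscale 0 w)" by (rule arg_cong)
  then show False using w(2) by simp
qed

text \<open>The disc through \<open>b = t w\<close> takes the value \<open>a\<close> at \<open>0\<close> and the value \<open>0\<close> at \<open>t\<close>, because pulling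
  back \<open>\<rho>\<^sub>0 \<circ> \<psi>\<close> along \<open>\<phi>\<close> gives \<open>\<rho>\<^sub>0\<close>. The Schwarz lemma compares \<open>\<bar>a\<bar>\<close> with \<open>t\<close>, and if they agree it
  determines the disc.\<close>

lemma
  fixes I :: "'d::finite ncpoly set" and J :: "'e::finite ncpoly set"
  assumes I: "homogeneous_ideal I" and J: "homogeneous_ideal J"
    and \<phi>: "algebraic_isomorphism I J \<phi>" and \<psi>: "algebraic_isomorphism J I \<psi>"
    and inv: "\<And>x. x \<in> tensor_algebra I \<Longrightarrow> \<psi> (\<phi> x) = x"
    and a: "a = character_point I (vacuum_character J \<circ> \<phi>)"
    and b: "b = character_point J (vacuum_character I \<circ> \<psi>)" "b = cscale (of_real t) w"
    and t: "0 < t" "t < 1" and w: "w \<in> variety J" "norm w = 1"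
  shows norm_vacuum_point_le: "norm a \<le> t"
    and image_of_vacuum_disc: "a = cscale (of_real t) v \<Longrightarrow> norm v = 1 \<Longrightarrow> cmod l < 1 \<Longrightarrow>
      character_point I (evaluation (cscale l w) \<circ> \<phi>) = cscale (disc_swap t l) v"
proof -
  let ?F = "\<lambda>l. character_point I (evaluation (cscale l w) \<circ> \<phi>)"
  note D = algebraic_isomorphismD[OF \<phi>]
  have chb: "character J (vacuum_character I \<circ> \<psi>)" by (intro character_comp[OF _ \<psi>] vacuum_character I)
  have F0: "?F 0 = a" unfolding a
    using evaluation_eq_vacuum_character[OF J w(1)] D(2) by (intro character_point_cong) auto
  have "?F (of_real t) = character_point I (vacuum_character I)"
  proof (rule character_point_cong)
    fix x assume x: "x \<in> tensor_algebra I"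
    have "evaluation (cscale (of_real t) w) (\<phi> x) = (vacuum_character I \<circ> \<psi>) (\<phi> x)"
    proof (rule character_eq_of_point[OF _ chb _ D(2)[OF x]])
      have "cscale (of_real t) w \<in> variety J" "norm (cscale (of_real t) w) < 1"
        using t w by (auto intro: variety_cscale)
      note E = character_evaluation[OF J this]
      show "character J (evaluation (cscale (of_real t) w))" by (rule E(1))
      show "character_point J (evaluation (cscale (of_real t) w)) = character_point J (vacuum_character I \<circ> \<psi>)"
        by (simp only: E(2) b(1)[symmetric]) (rule b(2)[symmetric])
    qed
    then show "(evaluation (cscale (of_real t) w) \<circ> \<phi>) x = vacuum_character I x"
      by (simp add: inv[OF x])
  qed
  then have Ft: "?F (of_real t) = 0" by (simp add: character_point_vacuum[OF I])
  note F = holomorphic_disc_of_characters[OF J \<phi> w]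
  show "norm a \<le> t"
    using holomorphic_disc_zero_le[OF F t Ft] F0 by (simp add: o_def)
  show "?F l = cscale (disc_swap t l) v" if "a = cscale (of_real t) v" "norm v = 1" "cmod l < 1"
    using holomorphic_disc_zero_eq[OF F t Ft _ that(2,3)] F0 that(1) by (simp add: o_def)
qed

lemma normalize_point:
  assumes "a \<noteq> 0" obtains v where "norm v = 1" "a = cscale (of_real (norm a)) v"
  using assms by (intro that[of "cscale (of_real (1 / norm a)) a"]) (auto simp: cscale_cscale norm_divide)

lemma cis_rotation:
  assumes "cmod x = cmod y" obtains t where "cis t * x = y"
proof (cases "x = 0")
  case False
  then have "y \<noteq> 0" using assms by auto
  then have "cis (Arg y - Arg x) * x = y"
    using False assms rcis_cmod_Arg[of x] rcis_cmod_Arg[of y]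
    by (metis cis_mult diff_add_cancel mult.left_commute rcis_def)
  then show ?thesis by (rule that)
qed (use assms that[of 0] in auto)

text \<open>The product is built so that, when the vacuum character of \<open>J\<close> is composed with its factors
  from left to right, the points of the resulting characters stay in the two discs matched by \<open>\<phi>\<close>, where
  the factors act by \<open>disc_swap\<close> and by rotations.\<close>

lemma vacuum_preserving_correction:
  fixes I :: "'d::finite ncpoly set" and J :: "'e::finite ncpoly set"
  assumes I: "homogeneous_ideal I" and J: "homogeneous_ideal J"
    and \<phi>: "algebraic_isomorphism I J \<phi>"
  obtains s t where
    "vacuum_preserving I J (\<phi> \<circ> (gauge_automorphism t \<circ> (isomorphism_inverse I \<phi> \<circ> (gauge_automorphism s \<circ> \<phi>))))"
proof -
  define \<psi> where "\<psi> = isomorphism_inverse I \<phi>"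
  have \<psi>: "algebraic_isomorphism J I \<psi>" unfolding \<psi>_def by (rule algebraic_isomorphism_inverse[OF \<phi>])
  note inv = isomorphism_inverse[OF \<phi>, folded \<psi>_def]
  note D = algebraic_isomorphismD(2)[OF \<phi>]
  define a where "a = character_point I (vacuum_character J \<circ> \<phi>)"
  define b where "b = character_point J (vacuum_character I \<circ> \<psi>)"
  have cha: "character I (vacuum_character J \<circ> \<phi>)" by (intro character_comp[OF _ \<phi>] vacuum_character J)
  have chb: "character J (vacuum_character I \<circ> \<psi>)" by (intro character_comp[OF _ \<psi>] vacuum_character I)
  have a0: "a = 0 \<longleftrightarrow> (\<forall>x\<in>tensor_algebra I. vacuum_character J (\<phi> x) = vacuum_character I x)"
    using character_eq_of_point[OF cha vacuum_character(1)[OF I]] character_point_vacuum[OF I]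
      character_point_cong[of I "vacuum_character J \<circ> \<phi>" "vacuum_character I"] unfolding a_def by auto
  have b0: "b = 0 \<longleftrightarrow> (\<forall>x\<in>tensor_algebra J. vacuum_character I (\<psi> x) = vacuum_character J x)"
    using character_eq_of_point[OF chb vacuum_character(1)[OF J]] character_point_vacuum[OF J]
      character_point_cong[of J "vacuum_character I \<circ> \<psi>" "vacuum_character J"] unfolding b_def by auto
  have ab: "a = 0 \<longleftrightarrow> b = 0" unfolding a0 b0 using inv D by metis
  show ?thesis
  proof (cases "a = 0")
    case True
    have "vacuum_preserving I J (\<phi> \<circ> (gauge_automorphism 0 \<circ> (\<psi> \<circ> (gauge_automorphism 0 \<circ> \<phi>))))"
      using True inv D unfolding a0 by (simp add: vacuum_preserving_def)
    then show ?thesis using that unfolding \<psi>_def by blast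
  next
    case False
    then have "b \<noteq> 0" using ab by simp
    obtain v where v: "norm v = 1" "a = cscale (of_real (norm a)) v" using normalize_point[OF False] .
    obtain w where w: "norm w = 1" "b = cscale (of_real (norm b)) w" using normalize_point[OF \<open>b \<noteq> 0\<close>] .
    have "v = cscale (of_real (1 / norm a)) a" "w = cscale (of_real (1 / norm b)) b"
      using v w False \<open>b \<noteq> 0\<close> by (metis cscale_cscale cscale_one of_real_mult of_real_1 norm_eq_zero nonzero_eq_divide_eq)+
    then have var: "v \<in> variety I" "w \<in> variety J"
      using character_point_in_variety[OF I cha] character_point_in_variety[OF J chb] variety_cscale
      unfolding a_def b_def by metis+
    have pos: "0 < norm a" "0 < norm b" using False \<open>b \<noteq> 0\<close> by simp_all
    have na: "norm a < 1" unfolding a_def by (rule character_point_vacuum_less_1[OF J \<phi> var(2) w(1)])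
    have nb: "norm b < 1" unfolding b_def by (rule character_point_vacuum_less_1[OF I \<psi> var(1) v(1)])
    have "norm a \<le> norm b"
      by (rule norm_vacuum_point_le[OF I J \<phi> \<psi> inv(3) a_def b_def w(2) pos(2) nb var(2) w(1)])
    moreover have "norm b \<le> norm a"
      by (rule norm_vacuum_point_le[OF J I \<psi> \<phi> inv(2) b_def a_def v(2) pos(1) na var(1) v(1)])
    ultimately have nab: "norm a = norm b" by simp
    define t where "t = norm b"
    have t: "0 < t" "t < 1" using pos nb by (simp_all add: t_def)
    have a_eq: "a = cscale (of_real t) v" and b_eq: "b = cscale (of_real t) w"
      using v w nab by (simp_all add: t_def)
    \<comment> \<open>Dually to \<open>\<phi>\<close>, the disc through \<open>b\<close> is mapped onto the disc through \<open>a\<close>, by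
      \<open>disc_swap t\<close> in the coordinates given by \<open>w\<close> and \<open>v\<close>.\<close>
    have disc: "character_point I (evaluation (cscale l w) \<circ> \<phi>) = cscale (disc_swap t l) v"
      if "cmod l < 1" for l
      by (rule image_of_vacuum_disc[OF I J \<phi> \<psi> inv(3) a_def b_def b_eq t var(2) w(1) a_eq v(1) that])
    obtain \<nu> where \<nu>: "cmod \<nu> = 1" "cmod (disc_swap t (\<nu> * of_real t)) = t"
      using disc_swap_rotation[OF t] .
    define l where "l = disc_swap t (\<nu> * of_real t)"
    obtain \<theta> where \<theta>: "cis \<theta> * 1 = \<nu>" by (rule cis_rotation[of 1 \<nu>]) (use \<nu> in auto)
    obtain s where s: "cis s * l = of_real t"
      by (rule cis_rotation[of l "of_real t"]) (use \<nu> t in \<open>auto simp: l_def\<close>)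
    have l1: "cmod l < 1" using \<nu> t by (simp add: l_def)
    have swap: "disc_swap t l = \<nu> * of_real t"
      unfolding l_def by (rule disc_swap_swap) (use \<nu> t in \<open>auto simp: norm_mult\<close>)
    have lw: "cscale l w \<in> variety J" "norm (cscale l w) < 1"
      using var(2) l1 w(1) by (auto intro: variety_cscale)
    note E = character_evaluation[OF J lw]
    \<comment> \<open>On the level of points: the vacuum of \<open>J\<close> goes to \<open>t v\<close>, is rotated to \<open>\<nu> t v\<close>, and
      this is the image of \<open>l w\<close>, where \<open>l = disc_swap t (\<nu> t)\<close>.\<close>
    have first_half: "vacuum_character J (\<phi> (gauge_automorphism \<theta> z)) = evaluation (cscale l w) (\<phi> z)"
      if z: "z \<in> tensor_algebra I" for z
    proof -
      have "((vacuum_character J \<circ> \<phi>) \<circ> gauge_automorphism \<theta>) z = (evaluation (cscale l w) \<circ> \<phi>) z"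
      proof (rule character_eq_of_point[OF character_comp[OF cha algebraic_isomorphism_gauge] character_comp[OF E(1) \<phi>] _ z])
        show "character_point I ((vacuum_character J \<circ> \<phi>) \<circ> gauge_automorphism \<theta>)
            = character_point I (evaluation (cscale l w) \<circ> \<phi>)"
          using \<theta> by (simp add: character_point_gauge[OF cha] a_def[symmetric] a_eq disc[OF l1] swap cscale_cscale
              del: o_assoc)
      qed
      then show ?thesis by simp
    qed
    \<comment> \<open>Since \<open>l\<close> has modulus \<open>t\<close>, a second rotation takes \<open>l w\<close> to \<open>t w = b\<close>, the
      preimage of the vacuum of \<open>I\<close>.\<close>
    have second_half: "evaluation (cscale l w) (gauge_automorphism s y) = vacuum_character I (\<psi> y)"
      if y: "y \<in> tensor_algebra J" for y
    proof -
      have "(evaluation (cscale l w) \<circ> gauge_automorphism s) y = (vacuum_character I \<circ> \<psi>) y"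
      proof (rule character_eq_of_point[OF character_comp[OF E(1) algebraic_isomorphism_gauge] chb _ y])
        show "character_point J (evaluation (cscale l w) \<circ> gauge_automorphism s)
            = character_point J (vacuum_character I \<circ> \<psi>)"
          by (simp add: character_point_gauge[OF E(1)] E(2) b_def[symmetric] b_eq cscale_cscale s)
      qed
      then show ?thesis by simp
    qed
    have "vacuum_preserving I J (\<phi> \<circ> (gauge_automorphism \<theta> \<circ> (\<psi> \<circ> (gauge_automorphism s \<circ> \<phi>))))"
      unfolding vacuum_preserving_def
    proof
      fix x assume x: "x \<in> tensor_algebra I"
      have gs: "gauge_automorphism s (\<phi> x) \<in> tensor_algebra J" by (intro gauge_in_tensor_algebra D x)
      show "vacuum_character J ((\<phi> \<circ> (gauge_automorphism \<theta> \<circ> (\<psi> \<circ> (gauge_automorphism s \<circ> \<phi>)))) x) = vacuum_character I x"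
        by (simp add: first_half[OF inv(1)[OF gs]] inv(2)[OF gs] second_half[OF D[OF x]] inv(3)[OF x])
    qed
    then show ?thesis using that unfolding \<psi>_def by blast
  qed
qed

theorem lemma3p3:
  fixes I :: "'d::finite ncpoly set" and J :: "'e::finite ncpoly set"
  assumes "homogeneous_ideal I" and "homogeneous_ideal J"
  shows "(\<forall>\<phi>. algebraic_isomorphism I J \<phi> \<longrightarrow>
            (\<exists>\<phi>'. algebraic_isomorphism I J \<phi>' \<and> vacuum_preserving I J \<phi>')) \<and>
         (\<forall>\<phi>. bounded_isomorphism I J \<phi> \<longrightarrow>
            (\<exists>\<phi>'. bounded_isomorphism I J \<phi>' \<and> vacuum_preserving I J \<phi>')) \<and>
         (\<forall>\<phi>. isometric_isomorphism I J \<phi> \<longrightarrow>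
            (\<exists>\<phi>'. isometric_isomorphism I J \<phi>' \<and> vacuum_preserving I J \<phi>'))"
proof (intro conjI allI impI)
  fix \<phi> :: "('d list ell2 \<Rightarrow>\<^sub>L 'd list ell2) \<Rightarrow> ('e list ell2 \<Rightarrow>\<^sub>L 'e list ell2)"
  let ?\<phi>' = "\<lambda>s t. \<phi> \<circ> (gauge_automorphism t \<circ> (isomorphism_inverse I \<phi> \<circ> (gauge_automorphism s \<circ> \<phi>)))"
  {
    assume \<phi>: "algebraic_isomorphism I J \<phi>"
    obtain s t where "vacuum_preserving I J (?\<phi>' s t)"
      using vacuum_preserving_correction[OF assms \<phi>] .
    moreover have "algebraic_isomorphism I J (?\<phi>' s t)"
      by (intro algebraic_isomorphism_comp[OF algebraic_isomorphism_comp[OF algebraic_isomorphism_comp[OF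
          algebraic_isomorphism_comp[OF \<phi> algebraic_isomorphism_gauge] algebraic_isomorphism_inverse[OF \<phi>]] algebraic_isomorphism_gauge] \<phi>])
    ultimately show "\<exists>\<phi>'. algebraic_isomorphism I J \<phi>' \<and> vacuum_preserving I J \<phi>'" by blast
  next
    assume \<phi>: "bounded_isomorphism I J \<phi>"
    then have "algebraic_isomorphism I J \<phi>" by (simp add: bounded_isomorphism_def)
    then obtain s t where "vacuum_preserving I J (?\<phi>' s t)"
      using vacuum_preserving_correction[OF assms] by blast
    moreover have "bounded_isomorphism I J (?\<phi>' s t)"
      by (intro bounded_isomorphism_comp[OF bounded_isomorphism_comp[OF bounded_isomorphism_comp[OF
          bounded_isomorphism_comp[OF \<phi> bounded_isomorphism_gauge] bounded_isomorphism_inverse[OF \<phi>]] bounded_isomorphism_gauge] \<phi>])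
    ultimately show "\<exists>\<phi>'. bounded_isomorphism I J \<phi>' \<and> vacuum_preserving I J \<phi>'" by blast
  next
    assume \<phi>: "isometric_isomorphism I J \<phi>"
    then have "algebraic_isomorphism I J \<phi>" by (simp add: isometric_isomorphism_def)
    then obtain s t where "vacuum_preserving I J (?\<phi>' s t)"
      using vacuum_preserving_correction[OF assms] by blast
    moreover have "isometric_isomorphism I J (?\<phi>' s t)"
      by (intro isometric_isomorphism_comp[OF isometric_isomorphism_comp[OF isometric_isomorphism_comp[OF
          isometric_isomorphism_comp[OF \<phi> isometric_isomorphism_gauge] isometric_isomorphism_inverse[OF \<phi>]] isometric_isomorphism_gauge] \<phi>])
    ultimately show "\<exists>\<phi>'. isometric_isomorphism I J \<phi>' \<and> vacuum_preserving I J \<phi>'" by blast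
  }
qed

end
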